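(* Let $X_1,X_2,\dots$ be i.i.d. with probability mass function $p$ on $\mathbb N=\{0,1,2,\dots\}$, and let $\widehat p_n,\widehat p_n^R,\widehat p_n^G$ be the empirical, rearrangement and Grenander (maximum likelihood) estimators based on $X_1,\dots,X_n$. (i) Suppose that $p$ is monotone decreasing. Then, for every $n\ge 1$, almost surely, $$\max\{H(\widehat p_n^G,p),H(\widehat p_n^R,p)\}\le H(\widehat p_n,p),$$ $$\max\{\|\widehat p_n^G-p\|_k,\|\widehat p_n^R-p\|_k\}\le\|\widehat p_n-p\|_k\quad\text{for all }1\le k\le\infty.$$ (ii) If $p$ is the uniform distribution on $\{0,\dots,y\}$ for some $y\in\mathbb N$, then, for every $n\ge1$, almost surely, $H(\widehat p_n,p)=H(\widehat p_n^R,p)$ and $\|\widehat p_n^R-p\|_k=\|\widehat p_n-p\|_k$ for all $1\le k\le\infty$. (iii) If $\widehat p_n$ is monotone decreasing, then $\widehat p_n^G=\widehat p_n^R=\widehat p_n$. If $p$ is uniform on $\{0,\dots,y\}$ with $y\in\mathbb N$, then $$P(\widehat p_{n,0}\ge\widehat p_{n,1}\ge\cdots\ge\widehat p_{n,y})\to\frac1{(y+1)!}\qquad\text{as }n\to\infty.$$ If $p$ is strictly monotone decreasing on its support and its support is $\{0,\dots,y\}$ with $y\in\mathbb N$ (that is, $p_0>p_1>\dots>p_y>0$ and $p_x=0$ for $x>y$), then $$P(\widehat p_{n,0}\ge\widehat p_{n,1}\ge\cdots\ge\widehat p_{n,y})\to1\qquad\text{as }n\to\infty.$$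
   Context: $\mathbb N=\{0,1,2,\dots\}$. A probability mass function $p=(p_x)_{x\in\mathbb N}$ is monotone decreasing if $p_x\ge p_{x+1}$ for all $x\in\mathbb N$. The empirical estimator is $\widehat p_{n,x}=n^{-1}\#\{i\le n:X_i=x\}$. For a finite vector $w=(w_0,\dots,w_k)$, $\mathrm{rear}(w)$ is the vector of entries of $w$ sorted in nonincreasing order, and $\mathrm{gren}(w)$ is the vector of the $k+1$ left slopes, at $j=0,\dots,k$, of the least concave majorant of the points $\{(j,\sum_{i=0}^jw_i):j=-1,0,\dots,k\}$ (empty sum $=0$). The rearrangement estimator is $\widehat p_n^R=\mathrm{rear}(\widehat p_n)$ and the Grenander estimator (MLE) is $\widehat p_n^G=\mathrm{gren}(\widehat p_n)$; both operators are applied to the finite vector $(\widehat p_{n,x})_{0\le x\le\max_iX_i}$, and the results are extended by $0$ to $\mathbb N$. Metrics: $H^2(p,\tilde p)=\frac12\sum_{x\ge0}(\sqrt{p_x}-\sqrt{\tilde p_x})^2$ (Hellinger, $H\ge0$); $\|v\|_k=(\sum_{x\ge0}|v_x|^k)^{1/k}$ for $1\le k<\infty$ and $\|v\|_\infty=\sup_{x\ge0}|v_x|$. *)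

theory Defs
  imports "HOL-Probability.Probability"
begin

definition monotone_decreasing :: "(nat \<Rightarrow> real) \<Rightarrow> bool" where
  "monotone_decreasing q \<longleftrightarrow> (\<forall>x. q x \<ge> q (Suc x))"

definition empirical :: "(nat \<Rightarrow> 'a \<Rightarrow> nat) \<Rightarrow> nat \<Rightarrow> 'a \<Rightarrow> nat \<Rightarrow> real" where
  "empirical X n \<omega> x = real (card {i \<in> {1..n}. X i \<omega> = x}) / real n"

text \<open>A finite vector \<open>(w\<^sub>0, \<dots>, w\<^sub>k)\<close> is a list of length \<open>k + 1\<close>.\<close>

definition rear :: "real list \<Rightarrow> real list" where
  "rear w = rev (sort w)"

text \<open>The pointwise infimum of all concave functions on \<open>S\<close> lying above the points \<open>P\<close>;
  the value is meaningful only for arguments in \<open>S\<close>.\<close>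

definition least_concave_majorant :: "real set \<Rightarrow> (real \<times> real) set \<Rightarrow> real \<Rightarrow> real" where
  "least_concave_majorant S P t =
     (INF g \<in> {g. concave_on S g \<and> (\<forall>(s, v) \<in> P. v \<le> g s)}. g t)"

text \<open>The points \<open>(j, w\<^sub>0 + \<dots> + w\<^sub>j)\<close> for \<open>j = -1, \<dots>, k\<close>, indexed by \<open>m = j + 1\<close>.\<close>

definition cumulative_points :: "real list \<Rightarrow> (real \<times> real) set" where
  "cumulative_points w = (\<lambda>m. (real m - 1, \<Sum>i<m. w ! i)) ` {0..length w}"

definition gren :: "real list \<Rightarrow> real list" where
  "gren w = map (\<lambda>j. vector_derivative
       (least_concave_majorant {-1 .. real (length w) - 1} (cumulative_points w))
       (at_left (real j))) [0..<length w]"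

definition extend_by_zero :: "real list \<Rightarrow> nat \<Rightarrow> real" where
  "extend_by_zero w x = (if x < length w then w ! x else 0)"

text \<open>The vector of empirical frequencies at \<open>0, \<dots>, max\<^sub>i X\<^sub>i\<close>; intended for \<open>n \<ge> 1\<close>.\<close>

definition empirical_vector :: "(nat \<Rightarrow> 'a \<Rightarrow> nat) \<Rightarrow> nat \<Rightarrow> 'a \<Rightarrow> real list" where
  "empirical_vector X n \<omega> = map (empirical X n \<omega>) [0..<Suc (Max ((\<lambda>i. X i \<omega>) ` {1..n}))]"

definition rearrangement_estimator :: "(nat \<Rightarrow> 'a \<Rightarrow> nat) \<Rightarrow> nat \<Rightarrow> 'a \<Rightarrow> nat \<Rightarrow> real" where
  "rearrangement_estimator X n \<omega> = extend_by_zero (rear (empirical_vector X n \<omega>))"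

definition grenander_estimator :: "(nat \<Rightarrow> 'a \<Rightarrow> nat) \<Rightarrow> nat \<Rightarrow> 'a \<Rightarrow> nat \<Rightarrow> real" where
  "grenander_estimator X n \<omega> = extend_by_zero (gren (empirical_vector X n \<omega>))"

definition hellinger :: "(nat \<Rightarrow> real) \<Rightarrow> (nat \<Rightarrow> real) \<Rightarrow> real" where
  "hellinger p q = sqrt (1 / 2 * (\<Sum>x. (sqrt (p x) - sqrt (q x))\<^sup>2))"

text \<open>The norm of exponent \<open>k \<in> [1, \<infinity>]\<close>. The series and the supremum are the true ones only where
  they are finite, as they are for a difference of two nonnegative summable sequences.\<close>

definition lnorm :: "ereal \<Rightarrow> (nat \<Rightarrow> real) \<Rightarrow> real" where
  "lnorm k v = (if k = \<infinity> then (SUP x. \<bar>v x\<bar>)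
     else (\<Sum>x. \<bar>v x\<bar> powr real_of_ereal k) powr (1 / real_of_ereal k))"

end

theory Submission
  imports Defs
begin

text \<open>Let \<open>G\<close> be the least concave majorant of the cumulative sums \<open>W\<close> of \<open>w\<close>. Then \<open>W \<le> G\<close>, with equality at
  both ends and wherever the slope of \<open>G\<close> changes. For convex \<open>\<phi>\<close> with subgradient \<open>\<sigma>\<close>, summation by parts
  of \<open>\<sigma> (gren w i - p i) * (w i - gren w i)\<close> therefore only meets increments of \<open>\<sigma>\<close> inside blocks on
  which \<open>gren w\<close> is constant, where they are nonnegative because \<open>p\<close> decreases. Hence \<open>gren\<close> decreases
  \<open>\<Sum> \<phi> (w i - p i)\<close>; \<open>rear\<close> does so because each transposition of an insertion sort does. The powers
  and \<open>max (\<bar>t\<bar> - c) 0\<close> as \<open>\<phi>\<close> give the norms, and the concave square root gives the Hellinger distance.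

  For uniform \<open>p\<close> all \<open>(y + 1)!\<close> orderings of the frequencies are equally likely by exchangeability, and
  ties have vanishing probability by the central limit theorem. For strictly decreasing \<open>p\<close>, Hoeffding's
  inequality excludes each inversion of neighbouring frequencies.\<close>

subsection \<open>Least concave majorants of cumulative sums\<close>

definition concave_seq :: "nat \<Rightarrow> (nat \<Rightarrow> real) \<Rightarrow> bool" where
  "concave_seq L A \<longleftrightarrow> (\<forall>m. Suc m < L \<longrightarrow> A (Suc (Suc m)) - A (Suc m) \<le> A (Suc m) - A m)"

text \<open>The value \<open>A m\<close> sits at abscissa \<open>m - 1\<close>, as in \<^const>\<open>cumulative_points\<close>.\<close>

definition chord :: "(nat \<Rightarrow> real) \<Rightarrow> nat \<Rightarrow> real \<Rightarrow> real" where
  "chord A m t = A (Suc m) + (A (Suc m) - A m) * (t - real m)"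

text \<open>For a concave sequence the piecewise linear interpolant is the minimum of its chords,
  each extended to a full line. In this form concavity is immediate and no case distinction on the
  position of \<open>t\<close> arises.\<close>

definition interpolant :: "nat \<Rightarrow> (nat \<Rightarrow> real) \<Rightarrow> real \<Rightarrow> real" where
  "interpolant L A t = Min ((\<lambda>m. chord A m t) ` {..<L})"

lemma concave_seq_diff_antimono:
  assumes "concave_seq L A" "i \<le> j" "j < L"
  shows "A (Suc j) - A j \<le> A (Suc i) - A i"
  using assms(2,3)
proof (induction j rule: dec_induct)
  case (step n)
  then have "A (Suc (Suc n)) - A (Suc n) \<le> A (Suc n) - A n"
    using assms(1) by (auto simp: concave_seq_def)
  with step show ?case by simp
qed simp

text \<open>Increments to the right of the chord are at most its slope, those to the left at least.
  Walking away from the chord in either direction, the sequence can only fall below the extended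
  line.\<close>

lemma concave_seq_le_chord:
  assumes A: "concave_seq L A" and "m < L" "i \<le> L"
  shows "A i \<le> chord A m (real i - 1)"
proof (cases "m < i")
  case True
  then have "Suc m \<le> i" by simp
  then show ?thesis using assms(3)
  proof (induction i rule: dec_induct)
    case (step n)
    with concave_seq_diff_antimono[OF A, of m n] show ?case
      by (simp add: chord_def algebra_simps)
  qed (simp add: chord_def)
next
  case False
  then have "i \<le> m" by simp
  then show ?thesis
  proof (induction i rule: inc_induct)
    case (step n)
    with concave_seq_diff_antimono[OF A, of n m] \<open>m < L\<close> show ?case
      by (simp add: chord_def algebra_simps)
  qed (simp add: chord_def)
qed

lemma chord_affine:
  assumes "u + v = 1"
  shows "chord A m (u * x + v * y) = u * chord A m x + v * chord A m y"
proof -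
  have u: "u = 1 - v" using assms by simp
  show ?thesis unfolding chord_def u by (simp add: algebra_simps)
qed

lemma interpolant_le_chord: "m < L \<Longrightarrow> interpolant L A t \<le> chord A m t"
  by (auto simp: interpolant_def)

lemma interpolant_attained:
  assumes "0 < L"
  obtains m where "m < L" "interpolant L A t = chord A m t"
proof -
  have "interpolant L A t \<in> (\<lambda>m. chord A m t) ` {..<L}"
    unfolding interpolant_def using assms by (intro Min_in) auto
  then show ?thesis using that by auto
qed

lemma concave_on_interpolant:
  assumes "0 < L" "convex S"
  shows "concave_on S (interpolant L A)"
  unfolding concave_on_iff
proof (intro conjI ballI allI impI assms(2))
  fix x y u v :: real assume uv: "u \<ge> 0" "v \<ge> 0" "u + v = 1"
  obtain m where m: "m < L" "interpolant L A (u * x + v * y) = chord A m (u * x + v * y)"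
    using interpolant_attained[OF assms(1)] by blast
  show "u * interpolant L A x + v * interpolant L A y \<le> interpolant L A (u *\<^sub>R x + v *\<^sub>R y)"
    using interpolant_le_chord[OF m(1), of A] uv m
    by (simp add: chord_affine add_mono mult_left_mono)
qed

text \<open>Whichever chord \<open>k\<close> attains the minimum at \<open>t\<close>, it lies above
  the sequence at both ends of the interval containing \<open>t\<close>. Being affine, it lies above
  chord \<open>m\<close> in between.\<close>

lemma interpolant_eq_chord:
  assumes A: "concave_seq L A" and "m < L" and t: "real m - 1 \<le> t" "t \<le> real m"
  shows "interpolant L A t = chord A m t"
proof (rule antisym)
  show "interpolant L A t \<le> chord A m t" using assms by (simp add: interpolant_le_chord)
  obtain k where k: "k < L" "interpolant L A t = chord A k t"
    using interpolant_attained assms by (metis gr0I less_zeroE)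
  define v where "v = t - (real m - 1)"
  have v: "0 \<le> 1 - v" "0 \<le> v" "(1 - v) + v = 1" using t by (auto simp: v_def)
  have tt: "t = (1 - v) * (real m - 1) + v * (real (Suc m) - 1)"
    by (simp add: v_def algebra_simps)
  have "chord A m t = (1 - v) * A m + v * A (Suc m)"
    by (simp add: tt chord_def algebra_simps)
  also have "\<dots> \<le> (1 - v) * chord A k (real m - 1) + v * chord A k (real (Suc m) - 1)"
    using v assms k by (intro add_mono mult_left_mono concave_seq_le_chord[OF A]) auto
  also have "\<dots> = chord A k t"
    unfolding tt by (rule chord_affine[symmetric]) simp
  finally show "chord A m t \<le> interpolant L A t" using k by simp
qed

lemma interpolant_at_node:
  assumes A: "concave_seq L A" and "0 < L" "i \<le> L"
  shows "interpolant L A (real i - 1) = A i"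
proof (cases i)
  case 0
  then show ?thesis using interpolant_eq_chord[OF A, of 0 "-1"] assms by (simp add: chord_def)
next
  case (Suc m)
  then show ?thesis using interpolant_eq_chord[OF A, of m "real m"] assms by (simp add: chord_def)
qed

abbreviation cumulative_lcm :: "real list \<Rightarrow> real \<Rightarrow> real" where
  "cumulative_lcm w \<equiv> least_concave_majorant {-1 .. real (length w) - 1} (cumulative_points w)"

definition concave_majorants :: "real list \<Rightarrow> (real \<Rightarrow> real) set" where
  "concave_majorants w = {g. concave_on {-1 .. real (length w) - 1} g \<and>
     (\<forall>m\<le>length w. (\<Sum>i<m. w ! i) \<le> g (real m - 1))}"

lemma cumulative_lcm_eq: "cumulative_lcm w t = (INF g \<in> concave_majorants w. g t)"
proof -
  have "(\<forall>(s, v) \<in> cumulative_points w. v \<le> g s) \<longleftrightarrow>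
      (\<forall>m\<le>length w. (\<Sum>i<m. w ! i) \<le> g (real m - 1))" for g
    by (auto simp: cumulative_points_def)
  then show ?thesis
    by (simp add: least_concave_majorant_def concave_majorants_def)
qed

lemma concave_majorants_nonempty: "concave_majorants w \<noteq> {}"
proof -
  let ?c = "Max ((\<lambda>m. \<Sum>i<m. w ! i) ` {..length w})"
  have "(\<lambda>_. ?c) \<in> concave_majorants w"
    unfolding concave_majorants_def
  proof (intro CollectI conjI allI impI)
    show "concave_on {- 1..real (length w) - 1} (\<lambda>_. ?c)"
      by (simp add: concave_on_const)
  qed (auto intro: Max_ge)
  then show ?thesis by blast
qed

text \<open>A concave function is at least the smaller of its two end values, and these majorise the
  first and the last cumulative sum. The resulting common lower bound makes the real infimum over
  all majorants a genuine one.\<close>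

lemma concave_majorants_ge:
  assumes "t \<in> {-1 .. real (length w) - 1}" "0 < length w" "g \<in> concave_majorants w"
  shows "min 0 (\<Sum>i<length w. w ! i) \<le> g t"
proof -
  let ?L = "real (length w)" and ?c = "min 0 (\<Sum>i<length w. w ! i)"
  \<comment> \<open>The relative position of \<open>t\<close> in the interval from -1 to
    \<open>?L - 1\<close>.\<close>
  define u where "u = (t + 1) / ?L"
  have u: "0 \<le> u" "u \<le> 1" "(1 - u) *\<^sub>R (-1) + u *\<^sub>R (?L - 1) = t"
    using assms(1,2) by (auto simp: u_def field_simps)
  have c: "concave_on {-1 .. ?L - 1} g" and m: "\<forall>m\<le>length w. (\<Sum>i<m. w ! i) \<le> g (real m - 1)"
    using assms(3) by (auto simp: concave_majorants_def)
  have "?c \<le> g (-1)" using m[rule_format, of 0] by simp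
  moreover have "?c \<le> g (?L - 1)" using m[rule_format, of "length w"] by simp
  ultimately have "(1 - u) * ?c + u * ?c \<le> (1 - u) * g (-1) + u * g (?L - 1)"
    using u by (intro add_mono mult_left_mono) auto
  also have "\<dots> \<le> g ((1 - u) *\<^sub>R (-1) + u *\<^sub>R (?L - 1))"
    using u assms(2) by (intro concave_onD[OF c]) auto
  also have "\<dots> = g t" using u by simp
  finally show ?thesis by (simp add: algebra_simps)
qed

lemma cumulative_lcm_le:
  assumes "t \<in> {-1 .. real (length w) - 1}" "0 < length w" "g \<in> concave_majorants w"
  shows "cumulative_lcm w t \<le> g t"
  unfolding cumulative_lcm_eq
  using concave_majorants_ge[OF assms(1,2)] assms(3) by (intro cINF_lower bdd_belowI2)

lemma cumulative_lcm_greatest: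
  assumes "\<And>g. g \<in> concave_majorants w \<Longrightarrow> c \<le> g t"
  shows "c \<le> cumulative_lcm w t"
  unfolding cumulative_lcm_eq using concave_majorants_nonempty assms by (rule cINF_greatest)

lemma cumulative_lcm_in_concave_majorants:
  assumes "0 < length w"
  shows "cumulative_lcm w \<in> concave_majorants w"
  unfolding concave_majorants_def concave_on_iff
proof (intro CollectI conjI ballI allI impI)
  let ?S = "{-1 .. real (length w) - 1}"
  fix x y u v :: real
  assume xy: "x \<in> ?S" "y \<in> ?S" and uv: "0 \<le> u" "0 \<le> v" "u + v = 1"
  show "u * cumulative_lcm w x + v * cumulative_lcm w y \<le> cumulative_lcm w (u *\<^sub>R x + v *\<^sub>R y)"
  proof (rule cumulative_lcm_greatest)
    fix g assume g: "g \<in> concave_majorants w"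
    then have c: "concave_on ?S g" by (simp add: concave_majorants_def)
    have "u * cumulative_lcm w x + v * cumulative_lcm w y \<le> u * g x + v * g y"
      using uv xy g assms by (intro add_mono mult_left_mono cumulative_lcm_le) auto
    also have "\<dots> \<le> g (u *\<^sub>R x + v *\<^sub>R y)"
      using c uv xy by (auto simp: concave_on_iff)
    finally show "u * cumulative_lcm w x + v * cumulative_lcm w y \<le> g (u *\<^sub>R x + v *\<^sub>R y)" .
  qed
next
  fix m assume "m \<le> length w"
  then show "(\<Sum>i<m. w ! i) \<le> cumulative_lcm w (real m - 1)"
    by (intro cumulative_lcm_greatest) (auto simp: concave_majorants_def)
qed simp

lemma interpolant_in_concave_majorants:
  assumes "0 < length w" "concave_seq (length w) A" "\<And>m. m \<le> length w \<Longrightarrow> (\<Sum>i<m. w ! i) \<le> A m"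
  shows "interpolant (length w) A \<in> concave_majorants w"
  unfolding concave_majorants_def
  using assms concave_on_interpolant[OF assms(1), of "{-1 .. real (length w) - 1}" A]
  by (simp add: interpolant_at_node)

lemma concave_seq_of_concave_on:
  assumes "concave_on {-1 .. real L - 1} g"
  shows "concave_seq L (\<lambda>m. g (real m - 1))"
  unfolding concave_seq_def
proof (intro allI impI)
  fix m assume m: "Suc m < L"
  have "(1 - 1/2) * g (real m - 1) + 1/2 * g (real (Suc (Suc m)) - 1)
      \<le> g ((1 - 1/2) *\<^sub>R (real m - 1) + (1/2) *\<^sub>R (real (Suc (Suc m)) - 1))"
    using m by (intro concave_onD[OF assms]) auto
  also have "(1 - 1/2) *\<^sub>R (real m - 1) + (1/2) *\<^sub>R (real (Suc (Suc m)) - 1) = real (Suc m) - 1"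
    by (simp add: field_simps)
  finally show "g (real (Suc (Suc m)) - 1) - g (real (Suc m) - 1) \<le> g (real (Suc m) - 1) - g (real m - 1)"
    by (simp add: field_simps)
qed

definition lcm_nodes :: "real list \<Rightarrow> nat \<Rightarrow> real" where
  "lcm_nodes w m = cumulative_lcm w (real m - 1)"

lemma concave_seq_lcm_nodes:
  assumes "0 < length w"
  shows "concave_seq (length w) (lcm_nodes w)"
  unfolding lcm_nodes_def
  using cumulative_lcm_in_concave_majorants[OF assms]
  by (intro concave_seq_of_concave_on) (simp add: concave_majorants_def)

lemma lcm_nodes_ge:
  assumes "0 < length w" "m \<le> length w"
  shows "(\<Sum>i<m. w ! i) \<le> lcm_nodes w m"
  unfolding lcm_nodes_def
  using cumulative_lcm_in_concave_majorants[OF assms(1)] assms(2) by (simp add: concave_majorants_def)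

text \<open>Minimality passed from functions to sequences: the interpolant of a concave sequence
  above the cumulative sums is a concave majorant. The next three facts test this against
  modifications of a single node.\<close>

lemma lcm_nodes_le:
  assumes "0 < length w" "concave_seq (length w) A"
    "\<And>m. m \<le> length w \<Longrightarrow> (\<Sum>i<m. w ! i) \<le> A m" "m \<le> length w"
  shows "lcm_nodes w m \<le> A m"
proof -
  have "lcm_nodes w m \<le> interpolant (length w) A (real m - 1)"
    unfolding lcm_nodes_def using assms
    by (intro cumulative_lcm_le interpolant_in_concave_majorants) auto
  then show ?thesis using assms by (simp add: interpolant_at_node)
qed

text \<open>Lowering the first node to 0 only enlarges the first increment, so concavity survives
  and minimality forces equality.\<close>

lemma lcm_nodes_0:
  assumes "0 < length w"
  shows "lcm_nodes w 0 = 0"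
proof (rule antisym)
  have "lcm_nodes w 0 \<le> ((lcm_nodes w)(0 := 0)) 0"
  proof (rule lcm_nodes_le[OF assms, where A = "(lcm_nodes w)(0 := 0)"])
    show "concave_seq (length w) ((lcm_nodes w)(0 := 0))"
      using concave_seq_lcm_nodes[OF assms] lcm_nodes_ge[OF assms, of 0]
      by (fastforce simp: concave_seq_def)
  qed (use lcm_nodes_ge[OF assms] in auto)
  then show "lcm_nodes w 0 \<le> 0" by simp
  show "0 \<le> lcm_nodes w 0" using lcm_nodes_ge[OF assms, of 0] by simp
qed

text \<open>The mirror argument at the right end: lowering the last node only shrinks the last
  increment.\<close>

lemma lcm_nodes_length:
  assumes "0 < length w"
  shows "lcm_nodes w (length w) = (\<Sum>i<length w. w ! i)"
proof (rule antisym)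
  let ?L = "length w" let ?W = "\<Sum>i<?L. w ! i"
  have "lcm_nodes w ?L \<le> ((lcm_nodes w)(?L := ?W)) ?L"
  proof (rule lcm_nodes_le[OF assms, where A = "(lcm_nodes w)(?L := ?W)"])
    show "concave_seq ?L ((lcm_nodes w)(?L := ?W))"
      unfolding concave_seq_def
    proof (intro allI impI)
      fix m assume m: "Suc m < ?L"
      then have "lcm_nodes w (Suc (Suc m)) - lcm_nodes w (Suc m) \<le> lcm_nodes w (Suc m) - lcm_nodes w m"
        using concave_seq_lcm_nodes[OF assms] by (simp add: concave_seq_def)
      with m lcm_nodes_ge[OF assms, of ?L]
      show "((lcm_nodes w)(?L := ?W)) (Suc (Suc m)) - ((lcm_nodes w)(?L := ?W)) (Suc m)
          \<le> ((lcm_nodes w)(?L := ?W)) (Suc m) - ((lcm_nodes w)(?L := ?W)) m"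
        by (cases "Suc (Suc m) = ?L") auto
    qed
  qed (use lcm_nodes_ge[OF assms] in auto)
  then show "lcm_nodes w ?L \<le> ?W" by simp
  show "?W \<le> lcm_nodes w ?L" using lcm_nodes_ge[OF assms] by simp
qed

lemma lcm_nodes_linear:
  assumes "Suc m < length w" and gt: "(\<Sum>i<Suc m. w ! i) < lcm_nodes w (Suc m)"
  shows "lcm_nodes w (Suc (Suc m)) - lcm_nodes w (Suc m) = lcm_nodes w (Suc m) - lcm_nodes w m"
proof (rule ccontr)
  let ?L = "length w" and ?G = "lcm_nodes w"
  assume ne: "\<not> ?thesis"
  have L: "0 < ?L" using assms(1) by linarith
  have conc: "?G (Suc (Suc k)) - ?G (Suc k) \<le> ?G (Suc k) - ?G k" if "Suc k < ?L" for k
    using concave_seq_lcm_nodes[OF L] that by (simp add: concave_seq_def)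
  \<comment> \<open>The first bound keeps the lowered node above the cumulative sum. The second is
    half the drop in slope, because lowering a node by \<open>e\<close> reduces the drop there by
    \<open>2 * e\<close>; at the neighbouring nodes the drop only grows.\<close>
  define e where "e = min (?G (Suc m) - (\<Sum>i<Suc m. w ! i))
    (((?G (Suc m) - ?G m) - (?G (Suc (Suc m)) - ?G (Suc m))) / 2)"
  have e: "0 < e" "e \<le> ?G (Suc m) - (\<Sum>i<Suc m. w ! i)"
    "2 * e \<le> (?G (Suc m) - ?G m) - (?G (Suc (Suc m)) - ?G (Suc m))"
    using ne gt conc[OF assms(1)] unfolding e_def by (simp_all add: min_def field_simps)
  txt \<open>At a kink strictly above the cumulative sum, the node could be lowered.\<close>
  let ?A = "?G(Suc m := ?G (Suc m) - e)"
  have "?G (Suc m) \<le> ?A (Suc m)"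
  proof (rule lcm_nodes_le[OF L, where A = ?A])
    show "concave_seq ?L ?A"
      unfolding concave_seq_def
    proof (intro allI impI)
      fix k assume k: "Suc k < ?L"
      consider "k = m" | "Suc k = m" | "k = Suc m" | "k \<noteq> m" "Suc k \<noteq> m" "k \<noteq> Suc m" by blast
      then show "?A (Suc (Suc k)) - ?A (Suc k) \<le> ?A (Suc k) - ?A k"
        by cases (use e conc[OF k] in auto)
    qed
    fix k assume "k \<le> ?L"
    then show "(\<Sum>i<k. w ! i) \<le> ?A k"
      using lcm_nodes_ge[OF L, of k] e by (cases "k = Suc m") auto
  qed (use assms in auto)
  then show False using e by simp
qed

text \<open>The interpolant of the nodes is itself a majorant, which bounds the least one from
  above; concavity between adjacent nodes bounds it from below.\<close>

lemma cumulative_lcm_eq_chord: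
  assumes j: "j < length w" and t: "real j - 1 \<le> t" "t \<le> real j"
  shows "cumulative_lcm w t = chord (lcm_nodes w) j t"
proof (rule antisym)
  have L: "0 < length w" using j by linarith
  have S: "t \<in> {-1 .. real (length w) - 1}" using j t by auto
  have "cumulative_lcm w t \<le> interpolant (length w) (lcm_nodes w) t"
    using S L by (intro cumulative_lcm_le interpolant_in_concave_majorants)
      (auto simp: concave_seq_lcm_nodes lcm_nodes_ge)
  also have "\<dots> = chord (lcm_nodes w) j t"
    using j t L by (intro interpolant_eq_chord concave_seq_lcm_nodes)
  finally show "cumulative_lcm w t \<le> chord (lcm_nodes w) j t" .
  define v where "v = t - (real j - 1)"
  have v: "0 \<le> v" "v \<le> 1" using t by (auto simp: v_def)
  have c: "concave_on {-1 .. real (length w) - 1} (cumulative_lcm w)"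
    using cumulative_lcm_in_concave_majorants[OF L] by (simp add: concave_majorants_def)
  have tt: "(1 - v) *\<^sub>R (real j - 1) + v *\<^sub>R (real (Suc j) - 1) = t"
    by (simp add: v_def algebra_simps)
  have "chord (lcm_nodes w) j t = (1 - v) * lcm_nodes w j + v * lcm_nodes w (Suc j)"
    by (simp add: v_def chord_def algebra_simps)
  also have "\<dots> \<le> cumulative_lcm w ((1 - v) *\<^sub>R (real j - 1) + v *\<^sub>R (real (Suc j) - 1))"
    unfolding lcm_nodes_def using v j by (intro concave_onD[OF c]) auto
  finally show "chord (lcm_nodes w) j t \<le> cumulative_lcm w t" unfolding tt .
qed

lemma length_gren [simp]: "length (gren w) = length w"
  by (simp add: gren_def)

lemma gren_nth:
  assumes j: "j < length w"
  shows "gren w ! j = lcm_nodes w (Suc j) - lcm_nodes w j"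
proof -
  let ?d = "lcm_nodes w (Suc j) - lcm_nodes w j"
  have "(chord (lcm_nodes w) j has_vector_derivative ?d) (at (real j) within {..real j})"
    unfolding chord_def by (auto intro!: derivative_eq_intros)
  \<comment> \<open>The left derivative at \<open>j\<close> sees only points within distance 1 to
    the left, where the majorant is the chord over the interval from \<open>j - 1\<close> to
    \<open>j\<close>.\<close>
  then have "(cumulative_lcm w has_vector_derivative ?d) (at (real j) within {..real j})"
    by (rule has_vector_derivative_transform_within[where d = 1])
      (auto simp: cumulative_lcm_eq_chord[OF j] dist_real_def)
  then have "(cumulative_lcm w has_vector_derivative ?d) (at_left (real j))"
    by (rule has_vector_derivative_within_subset) auto
  then have "vector_derivative (cumulative_lcm w) (at_left (real j)) = ?d"
    by (intro vector_derivative_within) (auto simp: trivial_limit_at_left_real)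
  then show ?thesis using j by (simp add: gren_def)
qed

subsection \<open>Convex losses of the Grenander vector\<close>

lemma gren_antimono:
  assumes "i \<le> j" "j < length w"
  shows "gren w ! j \<le> gren w ! i"
proof -
  have "0 < length w" "i < length w" using assms by linarith+
  then show ?thesis
    using assms by (simp add: gren_nth concave_seq_diff_antimono[OF concave_seq_lcm_nodes])
qed

text \<open>The Hellinger bound divides by \<open>sqrt (gren w ! i)\<close>, hence strict
  positivity. Since the slopes decrease, it suffices to bound the last one away from 0.\<close>

lemma gren_pos:
  assumes nonneg: "\<And>i. i < length w \<Longrightarrow> 0 \<le> w ! i" and "w \<noteq> []" "0 < last w" and j: "j < length w"
  shows "0 < gren w ! j"
proof -
  let ?L = "length w"
  obtain k where k: "?L = Suc k" using \<open>w \<noteq> []\<close> by (cases ?L) auto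
  have last: "last w = w ! k" using k \<open>w \<noteq> []\<close> by (simp add: last_conv_nth)
  \<comment> \<open>The line of slope \<open>d\<close> through the final cumulative point descends
    by at most \<open>last w\<close> over the whole range, while every earlier cumulative sum lies
    at least \<open>last w\<close> below the total. So the line is a majorant, and the last slope is
    at least \<open>d\<close>.\<close>
  define d where "d = last w / real ?L"
  have d: "0 < d" using assms by (simp add: d_def)
  let ?A = "\<lambda>m. (\<Sum>i<?L. w ! i) - d * (real ?L - real m)"
  have "lcm_nodes w k \<le> ?A k"
  proof (rule lcm_nodes_le[where A = ?A])
    show "concave_seq ?L ?A" by (simp add: concave_seq_def algebra_simps)
    fix m assume m: "m \<le> ?L"
    show "(\<Sum>i<m. w ! i) \<le> ?A m"
    proof (cases "m = ?L")
      case False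
      with m k have mk: "m \<le> k" by simp
      have "d * (real ?L - real m) \<le> d * real ?L" using d by (intro mult_left_mono) auto
      also have "\<dots> = w ! k" using \<open>w \<noteq> []\<close> by (simp add: d_def last)
      also have "\<dots> + (\<Sum>i<m. w ! i) \<le> w ! k + (\<Sum>i<k. w ! i)"
        using mk nonneg k by (intro add_left_mono sum_mono2) auto
      finally show ?thesis using k by simp
    qed simp
  qed (use k in auto)
  then have "0 < lcm_nodes w (Suc k) - lcm_nodes w k"
    using lcm_nodes_length[of w] d k by (simp add: algebra_simps)
  then have "0 < gren w ! k" using gren_nth[of k w] k by simp
  also have "\<dots> \<le> gren w ! j" using j k by (intro gren_antimono) auto
  finally show ?thesis .
qed

text \<open>The cumulative deficit of \<open>w\<close> against \<open>gren w\<close> is nonpositive and vanishes wherever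
  \<open>gren w\<close> changes, so summation by parts only sees the increments of \<open>s\<close> inside the blocks.\<close>

lemma gren_sum_nonneg:
  assumes s: "\<And>m. Suc m < length w \<Longrightarrow> gren w ! Suc m = gren w ! m \<Longrightarrow> s m \<le> s (Suc m)"
  shows "0 \<le> (\<Sum>i<length w. s i * (w ! i - gren w ! i))"
proof (cases "w = []")
  case False
  let ?L = "length w"
  have L: "0 < ?L" using False by blast
  define D where "D m = (\<Sum>i<m. w ! i) - lcm_nodes w m" for m
  have diff: "w ! i - gren w ! i = D (Suc i) - D i" if "i < ?L" for i
    using that by (simp add: D_def gren_nth)
  \<comment> \<open>The partial sums dominate the boundary term of the summation by parts. At the
    last index this term vanishes because the totals agree.\<close>
  have "s m * D (Suc m) \<le> (\<Sum>i<Suc m. s i * (w ! i - gren w ! i))" if "m < ?L" for m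
    using that
  proof (induction m)
    case 0
    then show ?case using diff[of 0] lcm_nodes_0[OF L] by (simp add: D_def)
  next
    case (Suc m)
    have "0 \<le> (s m - s (Suc m)) * D (Suc m)"
    proof (cases "D (Suc m) = 0")
      case False
      have le: "D (Suc m) \<le> 0" using lcm_nodes_ge[OF L, of "Suc m"] Suc.prems by (simp add: D_def)
      then have "(\<Sum>i<Suc m. w ! i) < lcm_nodes w (Suc m)" using False by (simp add: D_def)
      then have "s m \<le> s (Suc m)"
        using Suc.prems lcm_nodes_linear[of m w] by (intro s) (auto simp: gren_nth)
      then show ?thesis using le by (simp add: mult_nonpos_nonpos)
    qed simp
    moreover have "(\<Sum>i<Suc (Suc m). s i * (w ! i - gren w ! i))
        = (\<Sum>i<Suc m. s i * (w ! i - gren w ! i)) + s (Suc m) * (D (Suc (Suc m)) - D (Suc m))"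
      using diff[of "Suc m"] Suc.prems by simp
    moreover have "s m * D (Suc m) \<le> (\<Sum>i<Suc m. s i * (w ! i - gren w ! i))"
      using Suc by simp
    ultimately show ?case by (simp add: algebra_simps)
  qed
  from this[of "?L - 1"] have "s (?L - 1) * D ?L \<le> (\<Sum>i<?L. s i * (w ! i - gren w ! i))"
    using L Suc_pred[OF L] by simp
  moreover have "D ?L = 0" using lcm_nodes_length[OF L] by (simp add: D_def)
  ultimately show ?thesis by simp
qed simp

text \<open>Differentiability cannot be assumed, since absolute values and positive parts occur
  among the losses. Monotonicity follows from the two subgradient inequalities with \<open>a\<close>
  and \<open>b\<close> exchanged.\<close>

lemma convex_subgradient:
  fixes \<phi> :: "real \<Rightarrow> real"
  assumes "convex_on UNIV \<phi>"
  obtains \<sigma> where "mono \<sigma>" "\<And>a b. \<phi> a + \<sigma> a * (b - a) \<le> \<phi> b"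
proof -
  have "\<exists>d. \<forall>b. \<phi> a + d * (b - a) \<le> \<phi> b" for a
    using convex_le_Inf_differential[OF assms, of a] by (intro exI allI) simp
  then obtain \<sigma> where \<sigma>: "\<And>a b. \<phi> a + \<sigma> a * (b - a) \<le> \<phi> b" by metis
  have "mono \<sigma>"
  proof (rule monoI)
    fix a b :: real assume ab: "a \<le> b"
    have "\<sigma> a * (b - a) \<le> \<sigma> b * (b - a)"
      using \<sigma>[of a b] \<sigma>[of b a] by (simp add: algebra_simps)
    then show "\<sigma> a \<le> \<sigma> b" using ab by (cases "a = b") auto
  qed
  with \<sigma> that show ?thesis by blast
qed

lemma gren_sum_convex_le:
  assumes "convex_on UNIV \<phi>" and q: "\<And>m. Suc m < length w \<Longrightarrow> q (Suc m) \<le> q m"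
  shows "(\<Sum>i<length w. \<phi> (gren w ! i - q i)) \<le> (\<Sum>i<length w. \<phi> (w ! i - q i))"
proof -
  obtain \<sigma> where \<sigma>: "mono \<sigma>" "\<And>a b. \<phi> a + \<sigma> a * (b - a) \<le> \<phi> b"
    using convex_subgradient[OF assms(1)] by blast
  \<comment> \<open>On a block where \<open>gren w\<close> is constant the argument grows with
    \<open>i\<close> because \<open>q\<close> decreases, so the monotone \<open>\<sigma>\<close>
    meets the hypothesis of \<open>gren_sum_nonneg\<close>.\<close>
  let ?s = "\<lambda>i. \<sigma> (gren w ! i - q i)"
  have "(\<Sum>i<length w. \<phi> (gren w ! i - q i))
      \<le> (\<Sum>i<length w. \<phi> (gren w ! i - q i)) + (\<Sum>i<length w. ?s i * (w ! i - gren w ! i))"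
    using gren_sum_nonneg[of w ?s] q by (simp add: monoD[OF \<sigma>(1)])
  also have "\<dots> \<le> (\<Sum>i<length w. \<phi> (w ! i - q i))"
    unfolding sum.distrib[symmetric]
  proof (rule sum_mono)
    fix i
    show "\<phi> (gren w ! i - q i) + ?s i * (w ! i - gren w ! i) \<le> \<phi> (w ! i - q i)"
      using \<sigma>(2)[of "gren w ! i - q i" "w ! i - q i"] by simp
  qed
  finally show ?thesis .
qed

lemma sum_gren: "(\<Sum>i<length w. gren w ! i) = (\<Sum>i<length w. w ! i)"
proof (cases "w = []")
  case False
  then have L: "0 < length w" by blast
  have "(\<Sum>i<length w. gren w ! i) = (\<Sum>i<length w. lcm_nodes w (Suc i) - lcm_nodes w i)"
    by (simp add: gren_nth)
  also have "\<dots> = (\<Sum>i<length w. w ! i)"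
    using lcm_nodes_0[OF L] lcm_nodes_length[OF L] by (subst sum_lessThan_telescope) simp
  finally show ?thesis .
qed simp

text \<open>The summand is not a function of the difference \<open>w ! i - q i\<close>, so the
  convex bound above does not cover it. The argument is repeated with tangents of the square root at
  \<open>gren w ! i\<close>.\<close>

lemma gren_sum_sqrt_ge:
  assumes nonneg: "\<And>i. i < length w \<Longrightarrow> 0 \<le> w ! i" and w: "w \<noteq> []" "0 < last w"
    and q: "\<And>m. Suc m < length w \<Longrightarrow> q (Suc m) \<le> q m" and q0: "\<And>i. 0 \<le> q i"
  shows "(\<Sum>i<length w. sqrt (w ! i) * sqrt (q i)) \<le> (\<Sum>i<length w. sqrt (gren w ! i) * sqrt (q i))"
proof -
  let ?g = "\<lambda>i. gren w ! i"
  \<comment> \<open>The derivative of the convex function \<open>- sqrt t * sqrt (q i)\<close> at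
    \<open>t = gren w ! i\<close>.\<close>
  let ?s = "\<lambda>i. - (sqrt (q i) / (2 * sqrt (?g i)))"
  have pos: "0 < ?g i" if "i < length w" for i
    using gren_pos[OF nonneg w that] by simp
  have "(\<Sum>i<length w. sqrt (w ! i) * sqrt (q i))
      \<le> (\<Sum>i<length w. sqrt (w ! i) * sqrt (q i)) + (\<Sum>i<length w. ?s i * (w ! i - ?g i))"
  proof -
    have "0 \<le> (\<Sum>i<length w. ?s i * (w ! i - ?g i))"
    proof (rule gren_sum_nonneg)
      fix m assume m: "Suc m < length w" "?g (Suc m) = ?g m"
      with q[of m] pos[of m] show "?s m \<le> ?s (Suc m)"
        by (simp add: divide_right_mono)
    qed
    then show ?thesis by simp
  qed
  also have "\<dots> \<le> (\<Sum>i<length w. sqrt (?g i) * sqrt (q i))"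
    unfolding sum.distrib[symmetric]
  proof (rule sum_mono)
    fix i assume "i \<in> {..<length w}"
    then have g: "0 < ?g i" and w0: "0 \<le> w ! i" using pos nonneg by auto
    \<comment> \<open>The tangent bound for the square root is the inequality of arithmetic and
      geometric means divided by \<open>2 * sqrt (?g i)\<close>.\<close>
    have "2 * sqrt (w ! i) * sqrt (?g i) \<le> w ! i + ?g i"
      using sum_squares_bound[of "sqrt (w ! i)" "sqrt (?g i)"] g w0 by simp
    then have "sqrt (w ! i) - (w ! i - ?g i) / (2 * sqrt (?g i)) \<le> sqrt (?g i)"
      using g by (simp add: field_simps)
    then have "(sqrt (w ! i) - (w ! i - ?g i) / (2 * sqrt (?g i))) * sqrt (q i) \<le> sqrt (?g i) * sqrt (q i)"
      using q0 by (intro mult_right_mono) auto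
    then show "sqrt (w ! i) * sqrt (q i) + ?s i * (w ! i - ?g i) \<le> sqrt (?g i) * sqrt (q i)"
      by (simp add: algebra_simps)
  qed
  finally show ?thesis .
qed

subsection \<open>Convex losses of the rearranged vector\<close>

text \<open>Decreasing order as an insertion sort with negated keys, which allows induction along
  the list.\<close>

lemma rear_eq_sort_key: "rear w = sort_key uminus w"
proof -
  have "sorted (map uminus (sort_key uminus w))" by (rule sorted_sort_key)
  then have "sorted (rev (sort_key uminus w))"
    by (simp add: sorted_map sorted_wrt_rev)
  then have "sort w = rev (sort_key uminus w)"
    by (intro properties_for_sort) simp_all
  then show ?thesis by (simp add: rear_def)
qed

lemma mset_rear [simp]: "mset (rear w) = mset w"
  by (simp add: rear_def)

lemma set_rear [simp]: "set (rear w) = set w"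
  by (simp add: rear_def)

lemma length_rear [simp]: "length (rear w) = length w"
  by (simp add: rear_def)

text \<open>The first hypothesis is an exchange condition: pairing the larger value with the larger
  weight costs no more. Insertion moves \<open>a\<close> past a larger head \<open>x\<close> by one
  such exchange and then continues in the tail with shifted weights.\<close>

lemma insort_sum_le:
  fixes f :: "real \<Rightarrow> real \<Rightarrow> real"
  assumes f: "\<And>a b p q. a \<le> b \<Longrightarrow> q \<le> p \<Longrightarrow> f b p + f a q \<le> f a p + f b q"
    and q: "\<And>m. m < length w \<Longrightarrow> q (Suc m) \<le> q m"
  shows "(\<Sum>i<Suc (length w). f (insort_key uminus a w ! i) (q i)) \<le> (\<Sum>i<Suc (length w). f ((a # w) ! i) (q i))"
  using q
proof (induction w arbitrary: q)
  case (Cons x w)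
  show ?case
  proof (cases "x \<le> a")
    case False
    have "(\<Sum>i<Suc (length w). f (insort_key uminus a w ! i) (q (Suc i)))
        \<le> (\<Sum>i<Suc (length w). f ((a # w) ! i) (q (Suc i)))"
      using Cons.prems by (intro Cons.IH) auto
    moreover have "f x (q 0) + f a (q (Suc 0)) \<le> f a (q 0) + f x (q (Suc 0))"
      using False Cons.prems[of 0] by (intro f) auto
    ultimately show ?thesis
      using False by (simp add: sum.lessThan_Suc_shift del: sum.lessThan_Suc)
  qed simp
qed simp

lemma rear_sum_le:
  fixes f :: "real \<Rightarrow> real \<Rightarrow> real"
  assumes f: "\<And>a b p q. a \<le> b \<Longrightarrow> q \<le> p \<Longrightarrow> f b p + f a q \<le> f a p + f b q"
    and q: "\<And>m. Suc m < length w \<Longrightarrow> q (Suc m) \<le> q m"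
  shows "(\<Sum>i<length w. f (rear w ! i) (q i)) \<le> (\<Sum>i<length w. f (w ! i) (q i))"
  using q
proof (induction w arbitrary: q)
  case (Cons a w)
  have "(\<Sum>i<length (a # w). f (rear (a # w) ! i) (q i))
      \<le> (\<Sum>i<Suc (length (rear w)). f ((a # rear w) ! i) (q i))"
    using insort_sum_le[of f "rear w" q a, OF f] Cons.prems
    by (simp add: rear_eq_sort_key del: sum.lessThan_Suc)
  also have "\<dots> \<le> (\<Sum>i<length (a # w). f ((a # w) ! i) (q i))"
    using Cons.IH[of "\<lambda>i. q (Suc i)"] Cons.prems
    by (simp add: sum.lessThan_Suc_shift del: sum.lessThan_Suc)
  finally show ?case .
qed simp

text \<open>The points \<open>b - p\<close> and \<open>a - q\<close> lie between
  \<open>a - p\<close> and \<open>b - q\<close> and have the same sum. They are therefore convex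
  combinations of these with mirrored weights \<open>u\<close> and \<open>1 - u\<close>, and adding
  the two convexity inequalities gives the claim.\<close>

lemma convex_swap_le:
  fixes \<phi> :: "real \<Rightarrow> real"
  assumes \<phi>: "convex_on UNIV \<phi>" and "a \<le> b" "q \<le> p"
  shows "\<phi> (b - p) + \<phi> (a - q) \<le> \<phi> (a - p) + \<phi> (b - q)"
proof (cases "(b - a) + (p - q) = 0")
  case True
  then have "a = b" "p = q" using assms by linarith+
  then show ?thesis by simp
next
  case False
  define u where "u = (b - a) / ((b - a) + (p - q))"
  have pos: "0 < (b - a) + (p - q)" using False assms by linarith
  have u: "0 \<le> u" "u \<le> 1" using assms pos by (auto simp: u_def field_simps)
  have u_eq: "u * ((b - a) + (p - q)) = b - a" using False by (simp add: u_def)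
  have 1: "(1 - u) *\<^sub>R (a - p) + u *\<^sub>R (b - q) = b - p"
    using u_eq by (simp add: algebra_simps)
  have 2: "(1 - u) *\<^sub>R (b - q) + u *\<^sub>R (a - p) = a - q"
    using u_eq by (simp add: algebra_simps)
  have "\<phi> (b - p) \<le> (1 - u) * \<phi> (a - p) + u * \<phi> (b - q)"
    using convex_onD[OF \<phi>, of u "a - p" "b - q"] u 1 by simp
  moreover have "\<phi> (a - q) \<le> (1 - u) * \<phi> (b - q) + u * \<phi> (a - p)"
    using convex_onD[OF \<phi>, of u "b - q" "a - p"] u 2 by simp
  ultimately show ?thesis by (simp add: algebra_simps)
qed

lemma rear_sum_convex_le:
  assumes "convex_on UNIV \<phi>" "\<And>m. Suc m < length w \<Longrightarrow> q (Suc m) \<le> q m"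
  shows "(\<Sum>i<length w. \<phi> (rear w ! i - q i)) \<le> (\<Sum>i<length w. \<phi> (w ! i - q i))"
  by (rule rear_sum_le[where f = "\<lambda>a p. \<phi> (a - p)"]) (use assms convex_swap_le in auto)

lemma rear_sum_sqrt_ge:
  assumes "\<And>m. Suc m < length w \<Longrightarrow> q (Suc m) \<le> q m"
  shows "(\<Sum>i<length w. sqrt (w ! i) * sqrt (q i)) \<le> (\<Sum>i<length w. sqrt (rear w ! i) * sqrt (q i))"
proof -
  have "(\<Sum>i<length w. - (sqrt (rear w ! i) * sqrt (q i))) \<le> (\<Sum>i<length w. - (sqrt (w ! i) * sqrt (q i)))"
  proof (rule rear_sum_le[where f = "\<lambda>a p. - (sqrt a * sqrt p)"])
    fix a b p q :: real assume "a \<le> b" "q \<le> p"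
    then have "0 \<le> (sqrt b - sqrt a) * (sqrt p - sqrt q)" by (intro mult_nonneg_nonneg) auto
    then show "- (sqrt b * sqrt p) + - (sqrt a * sqrt q) \<le> - (sqrt a * sqrt p) + - (sqrt b * sqrt q)"
      by (simp add: algebra_simps)
  qed (use assms in auto)
  then show ?thesis by (simp add: sum_negf)
qed

lemma sum_rear: "(\<Sum>i<length w. rear w ! i) = (\<Sum>i<length w. w ! i)"
proof -
  have "sum_list (rear w) = sum_list w"
    by (metis mset_rear sum_mset_sum_list)
  then show ?thesis by (simp add: sum_list_sum_nth atLeast0LessThan)
qed

lemma rear_eq_self:
  assumes "\<And>m. Suc m < length w \<Longrightarrow> w ! Suc m \<le> w ! m"
  shows "rear w = w"
proof -
  have "sorted_wrt (\<ge>) w"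
    using assms by (subst sorted_wrt_iff_nth_Suc_transp) (auto simp: transp_def)
  then have "sorted (rev w)" by (simp add: sorted_wrt_rev)
  then have "sort w = rev w" by (intro properties_for_sort) simp_all
  then show ?thesis by (simp add: rear_def)
qed

subsection \<open>Norms and Hellinger distance\<close>

lemma convex_on_abs_powr:
  assumes "1 \<le> r"
  shows "convex_on UNIV (\<lambda>t::real. \<bar>t\<bar> powr r)"
proof (rule convex_onI)
  fix u x y :: real assume u: "0 < u" "u < 1"
  \<comment> \<open>Settles the case where one argument is 0; convexity of the power on positive
    reals handles the rest.\<close>
  have shrink: "(c * \<bar>z\<bar>) powr r \<le> c * \<bar>z\<bar> powr r" if "0 < c" "c < 1" for c z :: real
  proof -
    have "c powr r \<le> c powr 1" using that assms by (intro powr_mono') auto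
    then show ?thesis using that by (simp add: powr_mult mult_right_mono)
  qed
  have "\<bar>(1 - u) *\<^sub>R x + u *\<^sub>R y\<bar> \<le> (1 - u) * \<bar>x\<bar> + u * \<bar>y\<bar>"
    using u abs_triangle_ineq[of "(1 - u) * x" "u * y"] by (simp add: abs_mult)
  then have "\<bar>(1 - u) *\<^sub>R x + u *\<^sub>R y\<bar> powr r \<le> ((1 - u) * \<bar>x\<bar> + u * \<bar>y\<bar>) powr r"
    using assms by (intro powr_mono2) auto
  also have "\<dots> \<le> (1 - u) * \<bar>x\<bar> powr r + u * \<bar>y\<bar> powr r"
  proof (cases "x = 0 \<or> y = 0")
    case True
    then show ?thesis using shrink[of "1 - u" x] shrink[of u y] u assms by auto
  next
    case False
    then show ?thesis
      using convex_onD[OF powr_convex[OF assms], of u "\<bar>x\<bar>" "\<bar>y\<bar>"] u by simp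
  qed
  finally show "\<bar>(1 - u) *\<^sub>R x + u *\<^sub>R y\<bar> powr r \<le> (1 - u) * \<bar>x\<bar> powr r + u * \<bar>y\<bar> powr r" .
qed simp

lemma convex_on_abs_excess: "convex_on UNIV (\<lambda>t::real. max (\<bar>t\<bar> - c) 0)"
proof (rule convex_onI)
  fix u x y :: real assume u: "0 < u" "u < 1"
  have "\<bar>(1 - u) *\<^sub>R x + u *\<^sub>R y\<bar> \<le> (1 - u) * \<bar>x\<bar> + u * \<bar>y\<bar>"
    using u abs_triangle_ineq[of "(1 - u) * x" "u * y"] by (simp add: abs_mult)
  then have "\<bar>(1 - u) *\<^sub>R x + u *\<^sub>R y\<bar> - c \<le> (1 - u) * (\<bar>x\<bar> - c) + u * (\<bar>y\<bar> - c)"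
    by (simp add: algebra_simps)
  also have "\<dots> \<le> (1 - u) * max (\<bar>x\<bar> - c) 0 + u * max (\<bar>y\<bar> - c) 0"
    using u by (intro add_mono mult_left_mono) auto
  finally show "max (\<bar>(1 - u) *\<^sub>R x + u *\<^sub>R y\<bar> - c) 0 \<le> (1 - u) * max (\<bar>x\<bar> - c) 0 + u * max (\<bar>y\<bar> - c) 0"
    using u by (intro max.boundedI) auto
qed simp

lemma suminf_le_initial_segment:
  fixes f g :: "nat \<Rightarrow> real"
  assumes g: "summable g" and tail: "\<And>x. L \<le> x \<Longrightarrow> f x = g x" and "(\<Sum>x<L. f x) \<le> (\<Sum>x<L. g x)"
  shows "(\<Sum>x. f x) \<le> (\<Sum>x. g x)"
proof -
  have eq: "f (x + L) = g (x + L)" for x using tail by simp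
  have "summable f" using g by (subst summable_iff_shift[of f L, symmetric]) (simp add: eq)
  then show ?thesis
    using suminf_split_initial_segment[of f L] suminf_split_initial_segment[OF g, of L] assms(3) eq by simp
qed

lemma summable_abs_powr:
  fixes v :: "nat \<Rightarrow> real"
  assumes v: "summable (\<lambda>x. \<bar>v x\<bar>)" and "1 \<le> r"
  shows "summable (\<lambda>x. \<bar>v x\<bar> powr r)"
proof (rule summable_comparison_test_ev[OF _ v])
  have "v \<longlonglongrightarrow> 0" using summable_LIMSEQ_zero[OF v] by (simp add: tendsto_rabs_zero_iff)
  then have "\<forall>\<^sub>F x in sequentially. \<bar>v x\<bar> < 1"
    by (auto simp: tendsto_iff dist_real_def dest: spec[of _ 1])
  then show "\<forall>\<^sub>F x in sequentially. norm (\<bar>v x\<bar> powr r) \<le> \<bar>v x\<bar>"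
  proof eventually_elim
    case (elim x)
    have "\<bar>v x\<bar> powr r \<le> \<bar>v x\<bar> powr 1" using elim assms by (intro powr_mono') auto
    then show ?case by simp
  qed
qed

text \<open>Domination for the convex functions \<open>\<lambda>t. max (\<bar>t\<bar> - c) 0\<close> with \<open>c\<close> the supremum of \<open>v\<close>
  settles the case \<open>k = \<infinity>\<close>.\<close>

lemma lnorm_le_of_convex_sums:
  assumes v: "summable (\<lambda>x. \<bar>v x\<bar>)" and tail: "\<And>x. L \<le> x \<Longrightarrow> u x = v x"
    and conv: "\<And>\<phi>. convex_on UNIV \<phi> \<Longrightarrow> (\<Sum>x<L. \<phi> (u x)) \<le> (\<Sum>x<L. \<phi> (v x))"
    and k: "1 \<le> k"
  shows "lnorm k u \<le> lnorm k v"
proof (cases "k = \<infinity>")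
  case True
  define c where "c = (SUP x. \<bar>v x\<bar>)"
  have "bdd_above (range (\<lambda>x. \<bar>v x\<bar>))"
    using summable_imp_Bseq[OF v] by (auto simp: Bseq_def bdd_above_def)
  then have vc: "\<bar>v x\<bar> \<le> c" for x
    unfolding c_def by (intro cSUP_upper) auto
  have "(\<Sum>x<L. max (\<bar>u x\<bar> - c) 0) \<le> (\<Sum>x<L. max (\<bar>v x\<bar> - c) 0)"
    by (rule conv[OF convex_on_abs_excess])
  also have "\<dots> = 0" using vc by (intro sum.neutral) (simp add: max_def)
  finally have "(\<Sum>x<L. max (\<bar>u x\<bar> - c) 0) = 0" by (intro antisym sum_nonneg) auto
  then have "max (\<bar>u x\<bar> - c) 0 = 0" if "x < L" for x
    using that by (subst (asm) sum_nonneg_eq_0_iff) auto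
  then have "\<bar>u x\<bar> \<le> c" for x
    using vc[of x] tail[of x] by (cases "x < L") (force simp: max_def split: if_splits)+
  then show ?thesis using True by (auto simp: lnorm_def c_def[symmetric] intro: cSUP_least)
next
  case False
  then obtain r where r: "k = ereal r" "1 \<le> r"
    using k by (cases k) (auto simp: one_ereal_def)
  have u: "summable (\<lambda>x. \<bar>u x\<bar>)"
    using summable_ignore_initial_segment[OF v, of L] tail
    by (subst summable_iff_shift[of _ L, symmetric]) simp
  have "(\<Sum>x. \<bar>u x\<bar> powr r) \<le> (\<Sum>x. \<bar>v x\<bar> powr r)"
    using r(2) tail conv[OF convex_on_abs_powr[OF r(2)]]
    by (intro suminf_le_initial_segment[of _ L] summable_abs_powr v) auto
  moreover have "0 \<le> (\<Sum>x. \<bar>u x\<bar> powr r)"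
    using summable_abs_powr[OF u r(2)] by (intro suminf_nonneg) auto
  ultimately show ?thesis using r by (simp add: lnorm_def powr_mono2)
qed

lemma summable_pmf: "summable (pmf (p :: nat pmf))"
  using integrable_pmf[of UNIV p] by (simp add: integrable_count_space_nat_iff)

lemma summable_extend_by_zero: "summable (extend_by_zero w)"
  by (rule summable_finite[of "{..<length w}"]) (auto simp: extend_by_zero_def)

lemma lnorm_extend_by_zero_le:
  fixes p :: "nat pmf"
  assumes "length v = length w" "1 \<le> k"
    and conv: "\<And>\<phi>. convex_on UNIV \<phi> \<Longrightarrow>
      (\<Sum>i<length w. \<phi> (v ! i - pmf p i)) \<le> (\<Sum>i<length w. \<phi> (w ! i - pmf p i))"
  shows "lnorm k (\<lambda>x. extend_by_zero v x - pmf p x) \<le> lnorm k (\<lambda>x. extend_by_zero w x - pmf p x)"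
proof (rule lnorm_le_of_convex_sums[where L = "length w"])
  show "summable (\<lambda>x. \<bar>extend_by_zero w x - pmf p x\<bar>)"
  proof (subst summable_iff_shift[of _ "length w", symmetric])
    show "summable (\<lambda>x. \<bar>extend_by_zero w (x + length w) - pmf p (x + length w)\<bar>)"
      using summable_ignore_initial_segment[OF summable_pmf, of p "length w"]
      by (simp add: extend_by_zero_def)
  qed
qed (use assms in \<open>auto simp: extend_by_zero_def\<close>)

text \<open>Expanding the square leaves the masses and the affinity. The masses on the initial
  segment agree and so do the tails, so the larger affinity gives the smaller distance.\<close>

lemma hellinger_extend_by_zero_le:
  fixes p :: "nat pmf"
  assumes len: "length v = length w"
    and v: "\<And>i. i < length w \<Longrightarrow> 0 \<le> v ! i" and w: "\<And>i. i < length w \<Longrightarrow> 0 \<le> w ! i"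
    and sum: "(\<Sum>i<length w. v ! i) = (\<Sum>i<length w. w ! i)"
    and sq: "(\<Sum>i<length w. sqrt (w ! i) * sqrt (pmf p i)) \<le> (\<Sum>i<length w. sqrt (v ! i) * sqrt (pmf p i))"
  shows "hellinger (extend_by_zero v) (pmf p) \<le> hellinger (extend_by_zero w) (pmf p)"
proof -
  let ?L = "length w"
  have expand: "(\<Sum>i<?L. (sqrt (extend_by_zero z i) - sqrt (pmf p i))\<^sup>2)
      = (\<Sum>i<?L. z ! i) + (\<Sum>i<?L. pmf p i) - 2 * (\<Sum>i<?L. sqrt (z ! i) * sqrt (pmf p i))"
    if "\<And>i. i < ?L \<Longrightarrow> 0 \<le> z ! i" "length z = ?L" for z
  proof -
    have "(\<Sum>i<?L. (sqrt (extend_by_zero z i) - sqrt (pmf p i))\<^sup>2)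
        = (\<Sum>i<?L. z ! i + pmf p i - 2 * (sqrt (z ! i) * sqrt (pmf p i)))"
      using that by (intro sum.cong) (auto simp: extend_by_zero_def power2_diff)
    then show ?thesis by (simp add: sum.distrib sum_subtractf sum_distrib_left)
  qed
  have "(\<Sum>x. (sqrt (extend_by_zero v x) - sqrt (pmf p x))\<^sup>2)
      \<le> (\<Sum>x. (sqrt (extend_by_zero w x) - sqrt (pmf p x))\<^sup>2)"
  proof (rule suminf_le_initial_segment[of _ ?L])
    show "summable (\<lambda>x. (sqrt (extend_by_zero w x) - sqrt (pmf p x))\<^sup>2)"
    proof (subst summable_iff_shift[of _ ?L, symmetric])
      show "summable (\<lambda>x. (sqrt (extend_by_zero w (x + ?L)) - sqrt (pmf p (x + ?L)))\<^sup>2)"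
        using summable_ignore_initial_segment[OF summable_pmf, of p ?L]
        by (simp add: extend_by_zero_def)
    qed
  qed (use expand[of v] expand[of w] assms in \<open>auto simp: extend_by_zero_def\<close>)
  then show ?thesis by (simp add: hellinger_def)
qed

section \<open>Transfer to the empirical, Grenander and rearrangement estimators\<close>

lemma empirical_nonneg: "0 \<le> empirical X n \<omega> x"
  by (simp add: empirical_def)

lemma empirical_vector_not_Nil: "empirical_vector X n \<omega> \<noteq> []"
  by (simp add: empirical_vector_def)

lemma empirical_vector_nth:
  "x < length (empirical_vector X n \<omega>) \<Longrightarrow> empirical_vector X n \<omega> ! x = empirical X n \<omega> x"
  by (simp add: empirical_vector_def del: upt_Suc)

lemma extend_by_zero_empirical_vector: "extend_by_zero (empirical_vector X n \<omega>) = empirical X n \<omega>"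
proof
  fix x
  show "extend_by_zero (empirical_vector X n \<omega>) x = empirical X n \<omega> x"
  proof (cases "x < length (empirical_vector X n \<omega>)")
    case True
    then show ?thesis by (simp add: extend_by_zero_def empirical_vector_nth)
  next
    case False
    then have x: "Max ((\<lambda>i. X i \<omega>) ` {1..n}) < x"
      by (simp add: empirical_vector_def)
    have "{i \<in> {1..n}. X i \<omega> = x} = {}"
    proof (rule equals0I)
      fix i assume "i \<in> {i \<in> {1..n}. X i \<omega> = x}"
      then have "x \<le> Max ((\<lambda>i. X i \<omega>) ` {1..n})" by (intro Max_ge) auto
      with x show False by simp
    qed
    then show ?thesis using False by (simp add: extend_by_zero_def empirical_def)
  qed
qed

text \<open>The vector stops at the largest observation, whose frequency is positive. This supplies
  the positive last entry that \<open>gren_pos\<close> asks for.\<close>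

lemma last_empirical_vector_pos:
  assumes "1 \<le> n"
  shows "0 < last (empirical_vector X n \<omega>)"
proof -
  let ?m = "Max ((\<lambda>i. X i \<omega>) ` {1..n})"
  have "?m \<in> (\<lambda>i. X i \<omega>) ` {1..n}" using assms by (intro Max_in) auto
  then have "{i \<in> {1..n}. X i \<omega> = ?m} \<noteq> {}" by auto
  then have "0 < card {i \<in> {1..n}. X i \<omega> = ?m}" by (simp add: card_gt_0_iff)
  then have "0 < empirical X n \<omega> ?m" using assms by (simp add: empirical_def)
  then show ?thesis by (simp add: empirical_vector_def)
qed

lemma lnorm_grenander_le:
  assumes "monotone_decreasing (pmf p)" "1 \<le> k"
  shows "lnorm k (\<lambda>x. grenander_estimator X n \<omega> x - pmf p x) \<le> lnorm k (\<lambda>x. empirical X n \<omega> x - pmf p x)"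
proof -
  let ?w = "empirical_vector X n \<omega>"
  have "lnorm k (\<lambda>x. extend_by_zero (gren ?w) x - pmf p x) \<le> lnorm k (\<lambda>x. extend_by_zero ?w x - pmf p x)"
    using assms by (intro lnorm_extend_by_zero_le gren_sum_convex_le) (auto simp: monotone_decreasing_def)
  then show ?thesis by (simp add: grenander_estimator_def extend_by_zero_empirical_vector)
qed

lemma lnorm_rearrangement_le:
  assumes "monotone_decreasing (pmf p)" "1 \<le> k"
  shows "lnorm k (\<lambda>x. rearrangement_estimator X n \<omega> x - pmf p x) \<le> lnorm k (\<lambda>x. empirical X n \<omega> x - pmf p x)"
proof -
  let ?w = "empirical_vector X n \<omega>"
  have "lnorm k (\<lambda>x. extend_by_zero (rear ?w) x - pmf p x) \<le> lnorm k (\<lambda>x. extend_by_zero ?w x - pmf p x)"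
    using assms by (intro lnorm_extend_by_zero_le rear_sum_convex_le) (auto simp: monotone_decreasing_def)
  then show ?thesis by (simp add: rearrangement_estimator_def extend_by_zero_empirical_vector)
qed

lemma hellinger_grenander_le:
  assumes "monotone_decreasing (pmf p)" "1 \<le> n"
  shows "hellinger (grenander_estimator X n \<omega>) (pmf p) \<le> hellinger (empirical X n \<omega>) (pmf p)"
proof -
  let ?w = "empirical_vector X n \<omega>"
  have nonneg: "0 \<le> ?w ! i" if "i < length ?w" for i
    using that by (simp add: empirical_vector_nth empirical_nonneg)
  have "hellinger (extend_by_zero (gren ?w)) (pmf p) \<le> hellinger (extend_by_zero ?w) (pmf p)"
  proof (rule hellinger_extend_by_zero_le)
    show "0 \<le> gren ?w ! i" if "i < length ?w" for i
      using gren_pos[OF nonneg empirical_vector_not_Nil last_empirical_vector_pos[OF assms(2)] that]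
      by simp
    show "(\<Sum>i<length ?w. sqrt (?w ! i) * sqrt (pmf p i)) \<le> (\<Sum>i<length ?w. sqrt (gren ?w ! i) * sqrt (pmf p i))"
      using assms(1) nonneg last_empirical_vector_pos[OF assms(2)]
      by (intro gren_sum_sqrt_ge empirical_vector_not_Nil) (auto simp: monotone_decreasing_def)
  qed (simp_all add: sum_gren nonneg)
  then show ?thesis by (simp add: grenander_estimator_def extend_by_zero_empirical_vector)
qed

lemma hellinger_rearrangement_le:
  assumes "monotone_decreasing (pmf p)"
  shows "hellinger (rearrangement_estimator X n \<omega>) (pmf p) \<le> hellinger (empirical X n \<omega>) (pmf p)"
proof -
  let ?w = "empirical_vector X n \<omega>"
  have nonneg: "0 \<le> ?w ! i" if "i < length ?w" for i
    using that by (simp add: empirical_vector_nth empirical_nonneg)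
  have "hellinger (extend_by_zero (rear ?w)) (pmf p) \<le> hellinger (extend_by_zero ?w) (pmf p)"
  proof (rule hellinger_extend_by_zero_le)
    show "0 \<le> rear ?w ! i" if "i < length ?w" for i
    proof -
      have "rear ?w ! i \<in> set ?w" using that by (metis length_rear nth_mem set_rear)
      then show ?thesis using nonneg by (metis in_set_conv_nth)
    qed
    show "(\<Sum>i<length ?w. sqrt (?w ! i) * sqrt (pmf p i)) \<le> (\<Sum>i<length ?w. sqrt (rear ?w ! i) * sqrt (pmf p i))"
      using assms by (intro rear_sum_sqrt_ge) (auto simp: monotone_decreasing_def)
  qed (simp_all add: sum_rear nonneg)
  then show ?thesis by (simp add: rearrangement_estimator_def extend_by_zero_empirical_vector)
qed

text \<open>The vector itself is an admissible decreasing target, so the squared distance from \<open>gren w\<close> to it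
  cannot exceed that of \<open>w\<close>.\<close>

lemma gren_eq_self:
  assumes "\<And>m. Suc m < length w \<Longrightarrow> w ! Suc m \<le> w ! m"
  shows "gren w = w"
proof -
  have "convex_on UNIV (\<lambda>t::real. t\<^sup>2)"
    using convex_on_abs_powr[of 2] by simp
  then have "(\<Sum>i<length w. (gren w ! i - w ! i)\<^sup>2) \<le> (\<Sum>i<length w. (w ! i - w ! i)\<^sup>2)"
    using assms by (rule gren_sum_convex_le)
  then have "(\<Sum>i<length w. (gren w ! i - w ! i)\<^sup>2) = 0"
    by (intro antisym sum_nonneg) auto
  then have "gren w ! i = w ! i" if "i < length w" for i
    using that by (subst (asm) sum_nonneg_eq_0_iff) auto
  then show ?thesis by (intro nth_equalityI) auto
qed

lemma estimators_eq_empirical: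
  assumes "monotone_decreasing (empirical X n \<omega>)"
  shows "grenander_estimator X n \<omega> = rearrangement_estimator X n \<omega>"
    "rearrangement_estimator X n \<omega> = empirical X n \<omega>"
proof -
  let ?w = "empirical_vector X n \<omega>"
  have w: "?w ! Suc m \<le> ?w ! m" if "Suc m < length ?w" for m
    using that assms by (simp add: empirical_vector_nth monotone_decreasing_def)
  show "grenander_estimator X n \<omega> = rearrangement_estimator X n \<omega>"
    "rearrangement_estimator X n \<omega> = empirical X n \<omega>"
    using rear_eq_self[OF w] gren_eq_self[OF w]
    by (simp_all add: grenander_estimator_def rearrangement_estimator_def extend_by_zero_empirical_vector)
qed

text \<open>The permutation fixes every index beyond the vector, so it relates the sequences on all
  of the naturals.\<close>

lemma rearrangement_estimator_permutes:
  obtains \<pi> where "\<pi> permutes {..<length (empirical_vector X n \<omega>)}"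
    "rearrangement_estimator X n \<omega> = empirical X n \<omega> \<circ> \<pi>"
proof -
  let ?w = "empirical_vector X n \<omega>"
  obtain \<pi> where \<pi>: "\<pi> permutes {..<length ?w}" "permute_list \<pi> ?w = rear ?w"
    using mset_eq_permutation[of "rear ?w" ?w] by auto
  have "extend_by_zero (rear ?w) x = extend_by_zero ?w (\<pi> x)" for x
    using permutes_in_image[OF \<pi>(1), of x] permutes_not_in[OF \<pi>(1), of x]
    by (cases "x < length ?w")
      (simp_all add: \<pi>(2)[symmetric] extend_by_zero_def permute_list_nth[OF \<pi>(1)])
  then have "rearrangement_estimator X n \<omega> = empirical X n \<omega> \<circ> \<pi>"
    by (auto simp: rearrangement_estimator_def extend_by_zero_empirical_vector)
  with \<pi>(1) that show ?thesis by blast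
qed

lemma suminf_comp_permutes:
  fixes f :: "nat \<Rightarrow> 'b::{comm_monoid_add, t2_space}"
  assumes \<pi>: "\<pi> permutes {..<L}" and f: "\<And>x. K \<le> x \<Longrightarrow> f x = 0"
  shows "(\<Sum>x. f (\<pi> x)) = (\<Sum>x. f x)"
proof -
  have \<pi>': "\<pi> permutes {..<max L K}" using \<pi> by (rule permutes_subset) auto
  have "(\<Sum>x. f (\<pi> x)) = (\<Sum>x<max L K. f (\<pi> x))"
    using permutes_not_in[OF \<pi>'] f by (intro suminf_finite) auto
  also have "\<dots> = (\<Sum>x<max L K. f x)"
    using sum.permute[OF \<pi>', of f] by (simp add: o_def)
  also have "\<dots> = (\<Sum>x. f x)"
    using f by (intro suminf_finite[symmetric]) auto
  finally show ?thesis .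
qed

lemma rearrangement_uniform:
  assumes bound: "\<And>i. i \<in> {1..n} \<Longrightarrow> X i \<omega> \<le> y" and n: "1 \<le> n" and p: "p = pmf_of_set {0..y}"
  shows "hellinger (empirical X n \<omega>) (pmf p) = hellinger (rearrangement_estimator X n \<omega>) (pmf p)"
    "lnorm k (\<lambda>x. rearrangement_estimator X n \<omega> x - pmf p x) = lnorm k (\<lambda>x. empirical X n \<omega> x - pmf p x)"
proof -
  let ?L = "length (empirical_vector X n \<omega>)" and ?e = "empirical X n \<omega>"
  obtain \<pi> where \<pi>: "\<pi> permutes {..<?L}" and r: "rearrangement_estimator X n \<omega> = ?e \<circ> \<pi>"
    by (rule rearrangement_estimator_permutes)
  \<comment> \<open>No observation exceeds \<open>y\<close>, so \<open>\<pi>\<close> moves only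
    indices on which the uniform mass function is constant. Relabelling by \<open>\<pi>\<close> thus
    leaves \<open>p\<close> unchanged while turning the empirical estimator into its
    rearrangement.\<close>
  have "?L \<le> Suc y"
    using bound n by (auto simp: empirical_vector_def)
  then have "pmf p (\<pi> x) = pmf p x" for x
    using permutes_in_image[OF \<pi>, of x] permutes_not_in[OF \<pi>, of x]
    by (cases "x < ?L") (auto simp: p)
  then have r': "rearrangement_estimator X n \<omega> = (\<lambda>x. ?e (\<pi> x))" "pmf p = (\<lambda>x. pmf p (\<pi> x))"
    by (auto simp: r)
  have zero: "?e x = 0" "pmf p x = 0" if "Suc y \<le> x" for x
    using that \<open>?L \<le> Suc y\<close> by (auto simp: p extend_by_zero_empirical_vector[symmetric] extend_by_zero_def)
  have "(\<Sum>x. (sqrt (?e (\<pi> x)) - sqrt (pmf p (\<pi> x)))\<^sup>2) = (\<Sum>x. (sqrt (?e x) - sqrt (pmf p x))\<^sup>2)"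
    by (rule suminf_comp_permutes[OF \<pi>, of "Suc y" "\<lambda>x. (sqrt (?e x) - sqrt (pmf p x))\<^sup>2"]) (simp add: zero)
  then show "hellinger ?e (pmf p) = hellinger (rearrangement_estimator X n \<omega>) (pmf p)"
    by (subst (2) r'(2)) (simp add: hellinger_def r'(1))
  have "lnorm k (\<lambda>x. ?e (\<pi> x) - pmf p (\<pi> x)) = lnorm k (\<lambda>x. ?e x - pmf p x)"
  proof (cases "k = \<infinity>")
    case True
    have "range (\<lambda>x. \<bar>?e (\<pi> x) - pmf p (\<pi> x)\<bar>) = range (\<lambda>x. \<bar>?e x - pmf p x\<bar>)"
      using image_image[of "\<lambda>x. \<bar>?e x - pmf p x\<bar>" \<pi> UNIV] permutes_surj[OF \<pi>] by simp
    then show ?thesis using True by (simp add: lnorm_def)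
  next
    case False
    have "(\<Sum>x. \<bar>?e (\<pi> x) - pmf p (\<pi> x)\<bar> powr real_of_ereal k) = (\<Sum>x. \<bar>?e x - pmf p x\<bar> powr real_of_ereal k)"
      by (rule suminf_comp_permutes[OF \<pi>, of "Suc y" "\<lambda>x. \<bar>?e x - pmf p x\<bar> powr real_of_ereal k"]) (simp add: zero)
    then show ?thesis using False by (simp add: lnorm_def)
  qed
  then show "lnorm k (\<lambda>x. rearrangement_estimator X n \<omega> x - pmf p x) = lnorm k (\<lambda>x. ?e x - pmf p x)"
    by (subst r'(2)) (simp add: r'(1))
qed

subsection \<open>Ordering of the empirical frequencies\<close>

text \<open>Used with \<open>Suc\<close>: the sample starts at index 1, whereas the central limit
  theorem is applied to variables indexed from 0.\<close>

lemma (in prob_space) indep_vars_reindex_inj: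
  assumes "indep_vars M' X (f ` I)" "inj_on f I"
  shows "indep_vars (\<lambda>i. M' (f i)) (\<lambda>i. X (f i)) I"
  unfolding indep_vars_def2
proof (intro conjI ballI)
  fix i assume "i \<in> I"
  then show "random_variable (M' (f i)) (X (f i))"
    using assms(1) by (auto simp: indep_vars_def2)
next
  let ?F = "\<lambda>i. {X i -` A \<inter> space M |A. A \<in> sets (M' i)}"
  have F: "indep_sets ?F (f ` I)" using assms(1) by (simp add: indep_vars_def2)
  show "indep_sets (\<lambda>i. ?F (f i)) I"
  proof (rule indep_setsI)
    fix i assume "i \<in> I"
    then show "?F (f i) \<subseteq> events" using F by (auto simp: indep_sets_def)
  next
    fix A J assume J: "J \<noteq> {}" "J \<subseteq> I" "finite J" and A: "\<forall>j\<in>J. A j \<in> ?F (f j)"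
    have inj: "inj_on f J" using assms(2) J(2) by (rule inj_on_subset)
    let ?B = "\<lambda>k. A (the_inv_into J f k)"
    have B: "?B (f j) = A j" if "j \<in> J" for j
      using that by (simp add: the_inv_into_f_f[OF inj])
    have "prob (\<Inter>k\<in>f ` J. ?B k) = (\<Prod>k\<in>f ` J. prob (?B k))"
      using J A B by (intro indep_setsD[OF F]) auto
    also have "(\<Inter>k\<in>f ` J. ?B k) = (\<Inter>j\<in>J. A j)" using B by auto
    also have "(\<Prod>k\<in>f ` J. prob (?B k)) = (\<Prod>j\<in>J. prob (A j))"
      using B by (simp add: prod.reindex[OF inj])
    finally show "prob (\<Inter>j\<in>J. A j) = (\<Prod>j\<in>J. prob (A j))" .
  qed
qed

text \<open>The sample mean of the score is the difference of two empirical frequencies, so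
  comparing frequencies becomes a question about sums of i.i.d. variables.\<close>

definition score :: "nat \<Rightarrow> nat \<Rightarrow> nat \<Rightarrow> real" where
  "score a b v = indicator {a} v - indicator {b} v"

lemma empirical_eq_sum: "empirical X n \<omega> x = (\<Sum>i\<in>{1..n}. indicator {x} (X i \<omega>)) / real n"
proof -
  have "(\<Sum>i\<in>{1..n}. indicator {x} (X i \<omega>)) = real (card ({1..n} \<inter> {i. X i \<omega> = x}))"
    by (simp add: indicator_def sum.If_cases)
  also have "{1..n} \<inter> {i. X i \<omega> = x} = {i \<in> {1..n}. X i \<omega> = x}" by auto
  finally show ?thesis by (simp add: empirical_def)
qed

lemma empirical_diff:
  "empirical X n \<omega> a - empirical X n \<omega> b = (\<Sum>i\<in>{1..n}. score a b (X i \<omega>)) / real n"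
  by (simp add: empirical_eq_sum score_def sum_subtractf diff_divide_distrib)

lemma borel_measurable_empirical:
  assumes "\<And>i. i \<in> {1..n} \<Longrightarrow> X i \<in> measurable N (count_space UNIV)"
  shows "(\<lambda>\<omega>. empirical X n \<omega> x) \<in> borel_measurable N"
  unfolding empirical_eq_sum
  by (intro borel_measurable_divide borel_measurable_sum borel_measurable_const, rule measurable_compose[OF assms]) auto

locale iid_sample = prob_space M for M :: "'a measure" +
  fixes X :: "nat \<Rightarrow> 'a \<Rightarrow> nat" and p :: "nat pmf"
  assumes indep: "indep_vars (\<lambda>_. count_space UNIV) X {1..}"
    and distr_X: "\<And>i. 1 \<le> i \<Longrightarrow> distr M (count_space UNIV) (X i) = measure_pmf p"
begin

lemma measurable_X: "1 \<le> i \<Longrightarrow> X i \<in> measurable M (count_space UNIV)"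
  using indep by (auto simp: indep_vars_def)

lemma measurable_empirical [measurable]: "(\<lambda>\<omega>. empirical X n \<omega> x) \<in> borel_measurable M"
  by (intro borel_measurable_empirical measurable_X) auto

lemma AE_X: "1 \<le> i \<Longrightarrow> AE \<omega> in M. X i \<omega> \<in> set_pmf p"
  using AE_distr_iff[OF measurable_X, of i "\<lambda>v. v \<in> set_pmf p"] AE_measure_pmf[of p]
  by (simp only: distr_X) simp

lemma expectation_X: 
  fixes g :: "nat \<Rightarrow> real"
  shows "1 \<le> i \<Longrightarrow> expectation (\<lambda>\<omega>. g (X i \<omega>)) = measure_pmf.expectation p g"
  using integral_distr[OF measurable_X, of i g] by (simp add: distr_X)

lemma distr_fun_X:
  "1 \<le> i \<Longrightarrow> distr M borel (\<lambda>\<omega>. g (X i \<omega>)) = distr (measure_pmf p) borel g"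
  using distr_distr[OF _ measurable_X, of g borel i] by (simp add: distr_X o_def)

lemma indep_fun_X: "J \<subseteq> {1..} \<Longrightarrow> indep_vars (\<lambda>_. borel) (\<lambda>i \<omega>. g (X i \<omega>)) J"
  by (rule indep_vars_compose2[OF indep_vars_subset[OF indep]]) auto

end

lemma integrable_pmf_indicator: "integrable (measure_pmf p) (indicator A :: _ \<Rightarrow> real)"
  by (intro integrable_real_indicator) (auto simp: measure_pmf.emeasure_eq_measure)

lemma expectation_score: "measure_pmf.expectation p (score a b) = pmf p a - pmf p b"
  unfolding score_def
  by (subst Bochner_Integration.integral_diff) (simp_all add: measure_pmf_single integrable_pmf_indicator)

lemma expectation_score_sq:
  assumes "a \<noteq> b"
  shows "measure_pmf.expectation p (\<lambda>v. (score a b v)\<^sup>2) = pmf p a + pmf p b"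
proof -
  have "(\<lambda>v. (score a b v)\<^sup>2) = (\<lambda>v. indicator {a} v + indicator {b} v)"
    using assms by (auto simp: score_def indicator_def fun_eq_iff)
  then show ?thesis
    by (simp add: Bochner_Integration.integral_add measure_pmf_single integrable_pmf_indicator)
qed

context iid_sample
begin

lemma prob_empirical_less_tendsto_0:
  assumes gt: "pmf p b < pmf p a"
  shows "(\<lambda>n. prob {\<omega> \<in> space M. empirical X n \<omega> a < empirical X n \<omega> b}) \<longlonglongrightarrow> 0"
proof (rule tendsto_sandwich[where f = "\<lambda>_. 0"])
  define \<mu> where "\<mu> = pmf p a - pmf p b"
  have \<mu>: "0 < \<mu>" using gt by (simp add: \<mu>_def)
  have mean: "expectation (\<lambda>\<omega>. score a b (X 1 \<omega>)) = \<mu>"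
    using expectation_X[of 1 "score a b"] by (simp add: expectation_score \<mu>_def)
  show "\<forall>\<^sub>F n in sequentially. prob {\<omega> \<in> space M. empirical X n \<omega> a < empirical X n \<omega> b}
      \<le> exp (- (\<mu>\<^sup>2 / 2) * real n)"
    using eventually_gt_at_top[of 0]
  proof eventually_elim
    case (elim n)
    interpret Hoeffding_ineq_iid M "{1..n}" "\<lambda>i \<omega>. score a b (X i \<omega>)" "\<lambda>\<omega>. score a b (X 1 \<omega>)" "-1" 1
      "expectation (\<lambda>\<omega>. score a b (X 1 \<omega>))"
    proof unfold_locales
      show "indep_vars (\<lambda>_. borel) (\<lambda>i \<omega>. score a b (X i \<omega>)) {1..n}"
        by (rule indep_fun_X) auto
      show "random_variable borel (\<lambda>\<omega>. score a b (X 1 \<omega>))"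
        by (rule measurable_compose[OF measurable_X]) auto
      show "distr M borel (\<lambda>\<omega>. score a b (X i \<omega>)) = distr M borel (\<lambda>\<omega>. score a b (X 1 \<omega>))"
        if "i \<in> {1..n}" for i
        using that by (simp add: distr_fun_X)
    qed (auto simp: score_def indicator_def)
    let ?S = "\<lambda>\<omega>. \<Sum>i\<in>{1..n}. score a b (X i \<omega>)"
    have [measurable]: "?S \<in> borel_measurable M" by measurable
    \<comment> \<open>An inversion makes the score sum negative, a deviation by at least
      \<open>n * \<mu>\<close> below its mean. Scores range over an interval of length 2, which
      yields the exponent \<open>- (\<mu>\<^sup>2 / 2) * n\<close>.\<close>
    have "prob {\<omega> \<in> space M. empirical X n \<omega> a < empirical X n \<omega> b} \<le> prob {\<omega> \<in> space M. ?S \<omega> \<le> real (card {1..n}) * \<mu> - real n * \<mu>}"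
    proof (rule finite_measure_mono)
      show "{\<omega> \<in> space M. empirical X n \<omega> a < empirical X n \<omega> b} \<subseteq> {\<omega> \<in> space M. ?S \<omega> \<le> real (card {1..n}) * \<mu> - real n * \<mu>}"
      proof safe
        fix \<omega> assume "empirical X n \<omega> a < empirical X n \<omega> b"
        then have "?S \<omega> / real n < 0" using empirical_diff[of X n \<omega> a b] by linarith
        then show "?S \<omega> \<le> real (card {1..n}) * \<mu> - real n * \<mu>"
          using elim by (simp add: divide_less_0_iff)
      qed
    qed measurable
    also have "\<dots> \<le> exp (- 2 * (real n * \<mu>)\<^sup>2 / (real (card {1..n}) * (1 - (- 1))\<^sup>2))"
      using Hoeffding_ineq_le[of "real n * \<mu>"] elim \<mu> unfolding mean by simp
    also have "- 2 * (real n * \<mu>)\<^sup>2 / (real (card {1..n}) * (1 - (- 1))\<^sup>2) = - (\<mu>\<^sup>2 / 2) * real n"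
      using elim by (simp add: power2_eq_square field_simps)
    finally show ?case .
  qed
  have "filterlim (\<lambda>n. \<mu>\<^sup>2 / 2 * real n) at_top sequentially"
    using \<mu> by (intro filterlim_tendsto_pos_mult_at_top[OF tendsto_const] filterlim_real_sequentially) simp
  then have "filterlim (\<lambda>n. - (\<mu>\<^sup>2 / 2 * real n)) at_bot sequentially"
    by (simp add: filterlim_uminus_at_top)
  then show "(\<lambda>n. exp (- (\<mu>\<^sup>2 / 2) * real n)) \<longlonglongrightarrow> 0"
    using filterlim_compose[OF exp_at_bot] by simp
qed auto

text \<open>A tie means that the normalised score sum is exactly 0. Its weak limit is the standard
  normal law, which has no atom at 0, so the set containing only 0 is a continuity set.\<close>

lemma prob_empirical_eq_tendsto_0:
  assumes "a \<noteq> b" "pmf p a = pmf p b" "0 < pmf p a"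
  shows "(\<lambda>n. prob {\<omega> \<in> space M. empirical X n \<omega> a = empirical X n \<omega> b}) \<longlonglongrightarrow> 0"
proof -
  define Z where "Z i \<omega> = score a b (X (Suc i) \<omega>)" for i \<omega>
  define \<sigma> where "\<sigma> = sqrt (2 * pmf p a)"
  have \<sigma>: "0 < \<sigma>" "\<sigma>\<^sup>2 = 2 * pmf p a" using assms(3) by (simp_all add: \<sigma>_def)
  define S where "S n \<omega> = (\<Sum>i<n. Z i \<omega>)" for n \<omega>
  have Z_meas [measurable]: "Z i \<in> borel_measurable M" for i
    unfolding Z_def by (rule measurable_compose[OF measurable_X]) auto
  have mean: "expectation (Z i) = 0" for i
    unfolding Z_def using expectation_X[of "Suc i" "score a b"] assms(2) by (simp add: expectation_score)
  have sq: "expectation (\<lambda>\<omega>. (Z i \<omega>)\<^sup>2) = \<sigma>\<^sup>2" for i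
    unfolding Z_def using expectation_X[of "Suc i" "\<lambda>v. (score a b v)\<^sup>2"] assms(1,2)
    by (simp add: expectation_score_sq \<sigma>)
  have "weak_conv_m (\<lambda>n. distr M borel (\<lambda>\<omega>. S n \<omega> / sqrt (real n * \<sigma>\<^sup>2))) std_normal_distribution"
    unfolding S_def
  proof (rule central_limit_theorem_zero_mean[where \<mu> = "distr (measure_pmf p) borel (score a b)"])
    show "indep_vars (\<lambda>i. borel) Z UNIV"
      unfolding Z_def
      by (rule indep_vars_reindex_inj[where f = Suc and X = "\<lambda>i \<omega>. score a b (X i \<omega>)" and M' = "\<lambda>_. borel"])
        (auto intro!: indep_fun_X)
    show "integrable M (\<lambda>x. (Z i x)\<^sup>2)" for i
    proof (rule integrable_const_bound[where B = 1])
      show "(\<lambda>x. (Z i x)\<^sup>2) \<in> borel_measurable M" by measurable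
    qed (auto simp: Z_def score_def indicator_def)
    show "distr M borel (Z i) = distr (measure_pmf p) borel (score a b)" for i
      unfolding Z_def by (rule distr_fun_X) simp
  qed (use mean sq \<sigma> in simp_all)
  moreover have "real_distribution (distr M borel (\<lambda>\<omega>. S n \<omega> / sqrt (real n * \<sigma>\<^sup>2)))" for n
    unfolding S_def by (rule real_distribution_distr) measurable
  moreover have null: "emeasure std_normal_distribution {0} = 0"
    by (simp add: emeasure_density)
  then have "emeasure std_normal_distribution (frontier {0}) = 0"
    by (simp add: frontier_def)
  ultimately have "(\<lambda>n. measure (distr M borel (\<lambda>\<omega>. S n \<omega> / sqrt (real n * \<sigma>\<^sup>2))) {0}) \<longlonglongrightarrow> measure std_normal_distribution {0}"
    by (intro weak_conv_imp_continuity_set_conv real_dist_normal_dist) auto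
  moreover have "measure std_normal_distribution {0} = 0"
    using null by (simp add: measure_def)
  moreover have "measure (distr M borel (\<lambda>\<omega>. S n \<omega> / sqrt (real n * \<sigma>\<^sup>2))) {0}
      = prob {\<omega> \<in> space M. empirical X n \<omega> a = empirical X n \<omega> b}" for n
  proof -
    \<comment> \<open>At \<open>n = 0\<close> both sides hold, because division by zero gives
      zero.\<close>
    have "S n \<omega> / sqrt (real n * \<sigma>\<^sup>2) = 0 \<longleftrightarrow> empirical X n \<omega> a = empirical X n \<omega> b" for \<omega>
    proof -
      have "S n \<omega> = (\<Sum>i\<in>{1..n}. score a b (X i \<omega>))"
        unfolding S_def Z_def by (rule sum.reindex_bij_witness[of _ "\<lambda>i. i - 1" Suc]) auto
      then have "empirical X n \<omega> a - empirical X n \<omega> b = S n \<omega> / real n"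
        by (simp add: empirical_diff)
      then show ?thesis using \<sigma> by auto
    qed
    then show ?thesis
      by (subst measure_distr) (auto simp: S_def vimage_def Int_def conj_commute)
  qed
  ultimately show ?thesis by simp
qed

end

section \<open>Sorting permutations and exchangeability\<close>

lemma exists_sorting_permutation:
  fixes e :: "nat \<Rightarrow> real"
  obtains \<pi> where "\<pi> permutes {..y}" "\<And>x. x < y \<Longrightarrow> e (\<pi> (Suc x)) \<le> e (\<pi> x)"
proof -
  let ?w = "map e [0..<Suc y]"
  obtain \<pi> where \<pi>: "\<pi> permutes {..<length ?w}" "permute_list \<pi> ?w = rear ?w"
    using mset_eq_permutation[of "rear ?w" ?w] by auto
  have y: "{..<length ?w} = {..y}" by (auto simp del: upt_Suc)
  have nth: "rear ?w ! x = e (\<pi> x)" if "x \<le> y" for x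
  proof -
    have "\<pi> x \<le> y" using permutes_in_image[OF \<pi>(1), of x] that unfolding y by simp
    then show ?thesis
      using permute_list_nth[OF \<pi>(1), of x] that by (simp add: \<pi>(2) del: upt_Suc)
  qed
  have "sorted_wrt (\<lambda>a b. b \<le> a) (rear ?w)" by (simp add: rear_def sorted_wrt_rev del: upt_Suc)
  then have sorted: "rear ?w ! Suc x \<le> rear ?w ! x" if "x < y" for x
    using that by (simp add: sorted_wrt_iff_nth_less del: upt_Suc)
  have "e (\<pi> (Suc x)) \<le> e (\<pi> x)" if "x < y" for x
    using sorted[OF that] nth[of x] nth[of "Suc x"] that by (simp del: upt_Suc)
  with \<pi>(1) that show ?thesis unfolding y by blast
qed

text \<open>A decreasing list is determined by its multiset, so all sorting permutations produce the
  same values. Without ties the permutation itself is then determined.\<close>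

lemma sorting_permutation_rear:
  fixes e :: "nat \<Rightarrow> real"
  assumes \<pi>: "\<pi> permutes {..y}" and "\<And>x. x < y \<Longrightarrow> e (\<pi> (Suc x)) \<le> e (\<pi> x)" and "x \<le> y"
  shows "e (\<pi> x) = rear (map e [0..<Suc y]) ! x"
proof -
  let ?w = "map e [0..<Suc y]"
  have y: "{..<length ?w} = {..y}" by (auto simp del: upt_Suc)
  have \<pi>': "\<pi> permutes {..<length ?w}" using \<pi> unfolding y .
  have nth: "permute_list \<pi> ?w ! i = e (\<pi> i)" if "i \<le> y" for i
  proof -
    have "\<pi> i \<le> y" using permutes_in_image[OF \<pi>, of i] that by simp
    then show ?thesis using permute_list_nth[OF \<pi>', of i] that by (simp del: upt_Suc)
  qed
  have "permute_list \<pi> ?w ! Suc m \<le> permute_list \<pi> ?w ! m" if "Suc m < length (permute_list \<pi> ?w)" for m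
  proof -
    have "m < y" using that by (simp del: upt_Suc)
    then show ?thesis using assms(2)[of m] nth[of m] nth[of "Suc m"] by simp
  qed
  then have "rear (permute_list \<pi> ?w) = permute_list \<pi> ?w" by (rule rear_eq_self)
  moreover have "sort (permute_list \<pi> ?w) = sort ?w"
    using mset_permute_list[OF \<pi>'] by (metis sorted_list_of_multiset_mset)
  ultimately have "rear ?w = permute_list \<pi> ?w" by (simp add: rear_def del: upt_Suc)
  then show ?thesis using nth[OF assms(3)] by simp
qed

lemma sorting_permutation_unique:
  fixes e :: "nat \<Rightarrow> real"
  assumes \<pi>: "\<pi> permutes {..y}" "\<And>x. x < y \<Longrightarrow> e (\<pi> (Suc x)) \<le> e (\<pi> x)"
    and \<sigma>: "\<sigma> permutes {..y}" "\<And>x. x < y \<Longrightarrow> e (\<sigma> (Suc x)) \<le> e (\<sigma> x)"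
    and inj: "inj_on e {..y}"
  shows "\<pi> = \<sigma>"
proof
  fix x
  show "\<pi> x = \<sigma> x"
  proof (cases "x \<le> y")
    case True
    then have "e (\<pi> x) = e (\<sigma> x)"
      using sorting_permutation_rear[of \<pi> y e x] sorting_permutation_rear[of \<sigma> y e x] \<pi> \<sigma> by simp
    then show ?thesis
      using inj True permutes_in_image[OF \<pi>(1), of x] permutes_in_image[OF \<sigma>(1), of x]
      by (simp add: inj_on_eq_iff)
  next
    case False
    then show ?thesis using permutes_not_in[OF \<pi>(1), of x] permutes_not_in[OF \<sigma>(1), of x] by simp
  qed
qed

lemma empirical_comp_inv:
  assumes "\<pi> permutes A"
  shows "empirical (\<lambda>i \<omega>. inv \<pi> (X i \<omega>)) n \<omega> x = empirical X n \<omega> (\<pi> x)"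
  using permutes_inv_eq[OF assms] by (auto simp: empirical_def intro!: arg_cong[where f = card])

text \<open>The event depends on the sample only through the joint law of the first \<open>n\<close>
  observations, a product of copies of \<open>p\<close>. It is therefore pulled back from an event
  \<open>E\<close> of the product space, where the coordinates serve as observations.\<close>

lemma prob_empirical_ordered_eq:
  assumes "iid_sample M X p" "iid_sample M Y p"
  shows "measure M {\<omega> \<in> space M. \<forall>x<y. empirical X n \<omega> x \<ge> empirical X n \<omega> (Suc x)}
    = measure M {\<omega> \<in> space M. \<forall>x<y. empirical Y n \<omega> x \<ge> empirical Y n \<omega> (Suc x)}"
proof (cases "n = 0")
  case False
  define P where "P = Pi\<^sub>M {1..n} (\<lambda>_. count_space (UNIV :: nat set))"
  define E where "E = {f \<in> space P. \<forall>x<y. empirical (\<lambda>i f. f i) n f x \<ge> empirical (\<lambda>i f. f i) n f (Suc x)}"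
  have meas: "(\<lambda>f. empirical (\<lambda>i f. f i) n f x) \<in> borel_measurable P" for x
    unfolding P_def by (rule borel_measurable_empirical) (rule measurable_component_singleton)
  have E: "E \<in> sets P"
  proof -
    have "E = {f \<in> space P. \<forall>x\<in>{..<y}. empirical (\<lambda>i f. f i) n f x \<ge> empirical (\<lambda>i f. f i) n f (Suc x)}"
      unfolding E_def by blast
    also have "\<dots> \<in> sets P"
      by (intro sets.sets_Collect_finite_All borel_measurable_le meas) auto
    finally show ?thesis .
  qed
  have law: "measure M {\<omega> \<in> space M. \<forall>x<y. empirical Z n \<omega> x \<ge> empirical Z n \<omega> (Suc x)}
      = measure (Pi\<^sub>M {1..n} (\<lambda>_. measure_pmf p)) E" if "iid_sample M Z p" for Z
  proof -
    interpret iid_sample M Z p by fact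
    let ?R = "\<lambda>\<omega>. \<lambda>i\<in>{1..n}. Z i \<omega>"
    have R: "?R \<in> measurable M P"
      unfolding P_def using measurable_X by (intro measurable_restrict) auto
    have "distr M P ?R = Pi\<^sub>M {1..n} (\<lambda>i. distr M (count_space UNIV) (Z i))"
      unfolding P_def
    proof (rule indep_vars_iff_distr_eq_PiM'[THEN iffD1])
      show "indep_vars (\<lambda>_. count_space UNIV) Z {1..n}"
        by (rule indep_vars_subset[OF indep]) auto
    qed (use False measurable_X in auto)
    also have "\<dots> = Pi\<^sub>M {1..n} (\<lambda>_. measure_pmf p)"
      by (intro PiM_cong distr_X) auto
    finally have "measure (Pi\<^sub>M {1..n} (\<lambda>_. measure_pmf p)) E = prob (?R -` E \<inter> space M)"
      using measure_distr[OF R E] by simp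
    moreover have emp: "empirical (\<lambda>i f. f i) n (?R \<omega>) = empirical Z n \<omega>" for \<omega>
      unfolding empirical_eq_sum by (intro ext arg_cong2[where f = "(/)"] sum.cong) auto
    have "?R \<omega> \<in> E \<longleftrightarrow> (\<forall>x<y. empirical Z n \<omega> x \<ge> empirical Z n \<omega> (Suc x))"
      if "\<omega> \<in> space M" for \<omega>
    proof -
      have "?R \<omega> \<in> space P" using R that by (rule measurable_space)
      then show ?thesis unfolding E_def mem_Collect_eq emp by (simp only: simp_thms)
    qed
    then have "?R -` E \<inter> space M = {\<omega> \<in> space M. \<forall>x<y. empirical Z n \<omega> x \<ge> empirical Z n \<omega> (Suc x)}"
      unfolding vimage_def by blast
    ultimately show ?thesis by simp
  qed
  show ?thesis using law[OF assms(1)] law[OF assms(2)] by simp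
qed (simp add: empirical_def)

context iid_sample
begin

text \<open>Relabelling each observation by \<open>inv \<pi>\<close> preserves the uniform law and
  independence, and the relabelled frequency at \<open>x\<close> is the original one at
  \<open>\<pi> x\<close>.\<close>

lemma prob_empirical_ordered_permutes:
  assumes p: "p = pmf_of_set {0..y}" and \<pi>: "\<pi> permutes {..y}"
  shows "prob {\<omega> \<in> space M. \<forall>x<y. empirical X n \<omega> (\<pi> x) \<ge> empirical X n \<omega> (\<pi> (Suc x))}
    = prob {\<omega> \<in> space M. \<forall>x<y. empirical X n \<omega> x \<ge> empirical X n \<omega> (Suc x)}"
proof -
  have inv: "inv \<pi> permutes {0..y}" using permutes_inv[OF \<pi>] by (simp add: atMost_atLeast0)
  have "iid_sample M (\<lambda>i \<omega>. inv \<pi> (X i \<omega>)) p"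
  proof unfold_locales
    show "indep_vars (\<lambda>_. count_space UNIV) (\<lambda>i \<omega>. inv \<pi> (X i \<omega>)) {1..}"
      by (rule indep_vars_compose2[OF indep]) auto
    fix i :: nat assume i: "1 \<le> i"
    have "distr M (count_space UNIV) (\<lambda>\<omega>. inv \<pi> (X i \<omega>)) = distr (measure_pmf p) (count_space UNIV) (inv \<pi>)"
      using distr_distr[OF _ measurable_X[OF i], of "inv \<pi>" "count_space UNIV"] distr_X[OF i] by (simp add: o_def)
    also have "\<dots> = measure_pmf (map_pmf (inv \<pi>) p)" by (simp add: map_pmf_rep_eq)
    also have "map_pmf (inv \<pi>) p = p"
      unfolding p using permutes_inj_on[OF inv] permutes_image[OF inv] by (subst map_pmf_of_set_inj) auto
    finally show "distr M (count_space UNIV) (\<lambda>\<omega>. inv \<pi> (X i \<omega>)) = measure_pmf p" .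
  qed
  then show ?thesis
    using prob_empirical_ordered_eq[of M "\<lambda>i \<omega>. inv \<pi> (X i \<omega>)" p X y n] iid_sample_axioms
    by (simp add: empirical_comp_inv[OF \<pi>])
qed

text \<open>The \<open>(y + 1)!\<close> ordering events cover the sample space and are disjoint off the ties.\<close>

lemma prob_empirical_ordered_uniform:
  assumes p: "p = pmf_of_set {0..y}"
  shows "(\<lambda>n. prob {\<omega> \<in> space M. \<forall>x<y. empirical X n \<omega> x \<ge> empirical X n \<omega> (Suc x)}) \<longlonglongrightarrow> 1 / fact (y + 1)"
proof -
  define A where "A n \<pi> = {\<omega> \<in> space M. \<forall>x<y. empirical X n \<omega> (\<pi> x) \<ge> empirical X n \<omega> (\<pi> (Suc x))}" for n \<pi>
  define D where "D = {(a, b). a \<le> y \<and> b \<le> y \<and> a \<noteq> b}"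
  define T where "T n = (\<Union>(a, b)\<in>D. {\<omega> \<in> space M. empirical X n \<omega> a = empirical X n \<omega> b})" for n
  define Perms where "Perms = {\<pi>. \<pi> permutes {..y}}"
  define q where "q n = prob {\<omega> \<in> space M. \<forall>x<y. empirical X n \<omega> x \<ge> empirical X n \<omega> (Suc x)}" for n
  have fin: "finite D"
    unfolding D_def by (rule finite_subset[of _ "{..y} \<times> {..y}"]) auto
  have A [measurable]: "A n \<pi> \<in> events" for n \<pi> unfolding A_def by measurable
  have T [measurable]: "T n \<in> events" for n unfolding T_def using fin by (intro sets.finite_UN) auto
  have Perms: "finite Perms" "card Perms = fact (y + 1)"
    unfolding Perms_def using finite_permutations[of "{..y}"] card_permutations[of "{..y}" "y + 1"] by auto
  have qA: "prob (A n \<pi>) = q n" if "\<pi> \<in> Perms" for n \<pi>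
    using prob_empirical_ordered_permutes[OF p, of \<pi> n] that by (simp add: A_def q_def Perms_def)
  have lower: "1 / fact (y + 1) \<le> q n" for n
  proof -
    have "space M \<subseteq> (\<Union>\<pi>\<in>Perms. A n \<pi>)"
    proof
      fix \<omega> assume "\<omega> \<in> space M"
      obtain \<pi> where "\<pi> permutes {..y}" "\<And>x. x < y \<Longrightarrow> empirical X n \<omega> (\<pi> (Suc x)) \<le> empirical X n \<omega> (\<pi> x)"
        using exists_sorting_permutation[of y "empirical X n \<omega>"] by blast
      with \<open>\<omega> \<in> space M\<close> show "\<omega> \<in> (\<Union>\<pi>\<in>Perms. A n \<pi>)" by (auto simp: A_def Perms_def)
    qed
    then have "prob (space M) \<le> prob (\<Union>\<pi>\<in>Perms. A n \<pi>)"
      using Perms(1) by (intro finite_measure_mono sets.finite_UN) auto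
    also have "\<dots> \<le> (\<Sum>\<pi>\<in>Perms. prob (A n \<pi>))"
      using Perms(1) by (intro finite_measure_subadditive_finite) auto
    also have "\<dots> = fact (y + 1) * q n" by (simp add: qA Perms(2) algebra_simps)
    finally have "1 \<le> q n * fact (y + 1)" by (simp only: prob_space mult.commute)
    then show ?thesis by (subst pos_divide_le_eq) (rule fact_gt_zero)
  qed
  have upper: "q n \<le> 1 / fact (y + 1) + prob (T n)" for n
  proof -
    have "disjoint_family_on (\<lambda>\<pi>. A n \<pi> - T n) Perms"
      unfolding disjoint_family_on_def
    proof (intro ballI impI, rule ccontr)
      fix \<pi> \<sigma> assume "\<pi> \<in> Perms" "\<sigma> \<in> Perms" "\<pi> \<noteq> \<sigma>" "(A n \<pi> - T n) \<inter> (A n \<sigma> - T n) \<noteq> {}"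
      then obtain \<omega> where \<omega>: "\<omega> \<in> A n \<pi>" "\<omega> \<in> A n \<sigma>" "\<omega> \<notin> T n" by blast
      \<comment> \<open>Off the ties the frequencies are distinct, so \<open>\<omega>\<close> admits
        only one sorting permutation.\<close>
      then have "inj_on (empirical X n \<omega>) {..y}"
        by (auto simp: T_def D_def A_def inj_on_def)
      then have "\<pi> = \<sigma>"
        using \<omega> \<open>\<pi> \<in> Perms\<close> \<open>\<sigma> \<in> Perms\<close>
        by (intro sorting_permutation_unique[of \<pi> y "empirical X n \<omega>" \<sigma>]) (auto simp: Perms_def A_def)
      with \<open>\<pi> \<noteq> \<sigma>\<close> show False ..
    qed
    then have "(\<Sum>\<pi>\<in>Perms. prob (A n \<pi> - T n)) = prob (\<Union>\<pi>\<in>Perms. A n \<pi> - T n)"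
      using Perms(1) by (intro finite_measure_finite_Union[symmetric]) auto
    also have "\<dots> \<le> 1" by simp
    finally have "(\<Sum>\<pi>\<in>Perms. prob (A n \<pi> - T n)) \<le> 1" .
    moreover have "(\<Sum>\<pi>\<in>Perms. q n - prob (T n)) \<le> (\<Sum>\<pi>\<in>Perms. prob (A n \<pi> - T n))"
    proof (rule sum_mono)
      fix \<pi> assume "\<pi> \<in> Perms"
      have "prob (A n \<pi>) \<le> prob ((A n \<pi> - T n) \<union> T n)"
        by (intro finite_measure_mono) auto
      also have "\<dots> \<le> prob (A n \<pi> - T n) + prob (T n)"
        by (intro measure_Un_le) auto
      finally show "q n - prob (T n) \<le> prob (A n \<pi> - T n)" using qA[OF \<open>\<pi> \<in> Perms\<close>, of n] by simp
    qed
    ultimately have "real (card Perms) * (q n - prob (T n)) \<le> 1" by simp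
    then have "(q n - prob (T n)) * fact (y + 1) \<le> 1"
      unfolding Perms(2) of_nat_fact by (simp only: mult.commute)
    then have "q n - prob (T n) \<le> 1 / fact (y + 1)" by (subst pos_le_divide_eq) (rule fact_gt_zero)
    then show ?thesis by simp
  qed
  have "(\<lambda>n. \<Sum>(a, b)\<in>D. prob {\<omega> \<in> space M. empirical X n \<omega> a = empirical X n \<omega> b}) \<longlonglongrightarrow> 0"
    by (rule tendsto_null_sum) (auto simp: D_def p intro!: prob_empirical_eq_tendsto_0)
  then have T0: "(\<lambda>n. prob (T n)) \<longlonglongrightarrow> 0"
  proof (rule tendsto_sandwich[rotated 3, where f = "\<lambda>_. 0"])
    show "\<forall>\<^sub>F n in sequentially. prob (T n) \<le> (\<Sum>(a, b)\<in>D. prob {\<omega> \<in> space M. empirical X n \<omega> a = empirical X n \<omega> b})"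
      unfolding T_def split_beta using fin
      by (intro always_eventually allI finite_measure_subadditive_finite) (auto simp: split_beta)
  qed auto
  show ?thesis
    unfolding q_def[symmetric]
  proof (rule tendsto_sandwich[of "\<lambda>_. 1 / fact (y + 1)" q _ "\<lambda>n. 1 / fact (y + 1) + prob (T n)"])
    show "(\<lambda>n. 1 / fact (y + 1) + prob (T n)) \<longlonglongrightarrow> 1 / fact (y + 1)"
      using tendsto_add[OF tendsto_const T0] by simp
  qed (use lower upper in auto)
qed

lemma prob_empirical_ordered_strict:
  assumes "\<And>x. x < y \<Longrightarrow> pmf p (Suc x) < pmf p x"
  shows "(\<lambda>n. prob {\<omega> \<in> space M. \<forall>x<y. empirical X n \<omega> x \<ge> empirical X n \<omega> (Suc x)}) \<longlonglongrightarrow> 1"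
proof -
  let ?A = "\<lambda>n. {\<omega> \<in> space M. \<forall>x<y. empirical X n \<omega> x \<ge> empirical X n \<omega> (Suc x)}"
  let ?B = "\<lambda>n x. {\<omega> \<in> space M. empirical X n \<omega> x < empirical X n \<omega> (Suc x)}"
  have lower: "1 - (\<Sum>x<y. prob (?B n x)) \<le> prob (?A n)" for n
  proof -
    have "1 - prob (?A n) = prob (space M - ?A n)" by (rule prob_compl[symmetric]) measurable
    also have "space M - ?A n = (\<Union>x<y. ?B n x)" by (auto simp: not_le)
    also have "prob \<dots> \<le> (\<Sum>x<y. prob (?B n x))"
      by (intro finite_measure_subadditive_finite) auto
    finally show ?thesis by simp
  qed
  have "(\<lambda>n. \<Sum>x<y. prob (?B n x)) \<longlonglongrightarrow> 0"
    by (rule tendsto_null_sum) (auto intro!: prob_empirical_less_tendsto_0 assms)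
  then have "(\<lambda>n. 1 - (\<Sum>x<y. prob (?B n x))) \<longlonglongrightarrow> 1"
    using tendsto_diff[OF tendsto_const, of _ 0 sequentially 1] by simp
  then show ?thesis
    by (rule tendsto_sandwich[rotated 2, where h = "\<lambda>_. 1"]) (use lower in auto)
qed

end

theorem theorem2p1:
  fixes M :: "'a measure" and X :: "nat \<Rightarrow> 'a \<Rightarrow> nat" and p :: "nat pmf"
  assumes "prob_space M"
    and indep: "prob_space.indep_vars M (\<lambda>_. count_space UNIV) X {1..}"
    and distr: "\<And>i. i \<ge> 1 \<Longrightarrow> distr M (count_space UNIV) (X i) = measure_pmf p"
  shows
    "(monotone_decreasing (pmf p) \<longrightarrow>
       (\<forall>n\<ge>1. AE \<omega> in M.
          max (hellinger (grenander_estimator X n \<omega>) (pmf p))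
              (hellinger (rearrangement_estimator X n \<omega>) (pmf p))
            \<le> hellinger (empirical X n \<omega>) (pmf p) \<and>
          (\<forall>k::ereal. 1 \<le> k \<longrightarrow>
             max (lnorm k (\<lambda>x. grenander_estimator X n \<omega> x - pmf p x))
                 (lnorm k (\<lambda>x. rearrangement_estimator X n \<omega> x - pmf p x))
               \<le> lnorm k (\<lambda>x. empirical X n \<omega> x - pmf p x))))
     \<and>
     (\<forall>y::nat. p = pmf_of_set {0..y} \<longrightarrow>
       (\<forall>n\<ge>1. AE \<omega> in M.
          hellinger (empirical X n \<omega>) (pmf p) = hellinger (rearrangement_estimator X n \<omega>) (pmf p) \<and>
          (\<forall>k::ereal. 1 \<le> k \<longrightarrow>
             lnorm k (\<lambda>x. rearrangement_estimator X n \<omega> x - pmf p x)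
               = lnorm k (\<lambda>x. empirical X n \<omega> x - pmf p x))))
     \<and>
     (\<forall>n\<ge>1. \<forall>\<omega>\<in>space M. monotone_decreasing (empirical X n \<omega>) \<longrightarrow>
        grenander_estimator X n \<omega> = rearrangement_estimator X n \<omega> \<and>
        rearrangement_estimator X n \<omega> = empirical X n \<omega>)
     \<and>
     (\<forall>y::nat. p = pmf_of_set {0..y} \<longrightarrow>
        (\<lambda>n. measure M {\<omega> \<in> space M. \<forall>x<y. empirical X n \<omega> x \<ge> empirical X n \<omega> (Suc x)})
          \<longlonglongrightarrow> 1 / fact (y + 1))
     \<and>
     (\<forall>y::nat. (\<forall>x<y. pmf p x > pmf p (Suc x)) \<and> pmf p y > 0 \<and> (\<forall>x>y. pmf p x = 0) \<longrightarrow>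
        (\<lambda>n. measure M {\<omega> \<in> space M. \<forall>x<y. empirical X n \<omega> x \<ge> empirical X n \<omega> (Suc x)})
          \<longlonglongrightarrow> 1)"
proof -
  interpret iid_sample M X p
    using assms by (simp add: iid_sample_def iid_sample_axioms_def)
  \<comment> \<open>Observations outside the support form a null set; this is where the uniform case
    holds only almost surely.\<close>
  have bound: "AE \<omega> in M. \<forall>i\<in>{1..n}. X i \<omega> \<le> y" if "p = pmf_of_set {0..y}" for n y
  proof (rule AE_finite_allI)
    fix i assume "i \<in> {1..n}"
    then show "AE \<omega> in M. X i \<omega> \<le> y"
      using AE_X[of i] that by simp
  qed simp
  have uniform: "AE \<omega> in M.
      hellinger (empirical X n \<omega>) (pmf p) = hellinger (rearrangement_estimator X n \<omega>) (pmf p) \<and>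
      (\<forall>k::ereal. 1 \<le> k \<longrightarrow> lnorm k (\<lambda>x. rearrangement_estimator X n \<omega> x - pmf p x)
         = lnorm k (\<lambda>x. empirical X n \<omega> x - pmf p x))"
    if "p = pmf_of_set {0..y}" "1 \<le> n" for n y
    using bound[OF that(1), of n]
  proof eventually_elim
    case (elim \<omega>)
    then show ?case
      using rearrangement_uniform[of n X \<omega> y p] that by blast
  qed
  show ?thesis
  proof (intro conjI allI impI, goal_cases)
    case (1 n)
    then show ?case
      \<comment> \<open>For decreasing \<open>p\<close> the inequalities hold at every sample
        point.\<close>
      by (intro AE_I2 conjI allI impI max.boundedI hellinger_grenander_le hellinger_rearrangement_le
          lnorm_grenander_le lnorm_rearrangement_le)
  next
    case (2 y n)
    then show ?case by (rule uniform)
  next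
    case (3 n)
    show ?case by (intro ballI impI conjI estimators_eq_empirical)
  next
    case (4 y)
    then show ?case by (rule prob_empirical_ordered_uniform)
  next
    case (5 y)
    then show ?case by (intro prob_empirical_ordered_strict) simp
  qed
qed

end
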